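(* Let $\Bbbk$ be a field, $S=\Bbbk[x_1,\ldots,x_n]$, and let $\mathfrak{a}=\mathfrak{f}+(G)\subseteq S$ be an Artinian almost complete intersection of degrees $(\mathbf{d};D)=(d_1,\ldots,d_n;D)$ with $D\le\sigma=\sum_{i=1}^n(d_i-1)$. Then $\operatorname{HF}(S/\mathfrak{a};m)\le\operatorname{HF}(S/(x_1^{d_1},\ldots,x_n^{d_n});m)-\varphi_m$ for all $D<m\le\sigma$. In particular, $\operatorname{e}(S/\mathfrak{a})\le\prod_{i=1}^n d_i-\sum_{m=D+1}^{\sigma}\varphi_m-1$.
   Context: $S$ is standard graded; $\operatorname{HF}(M;j)=\dim_\Bbbk M_j$; $\operatorname{e}$ is multiplicity. An almost complete intersection of degrees $(\mathbf{d};D)=(d_1,\ldots,d_h;D)$ is a homogeneous ideal $\mathfrak{a}$ of height $h$ with $\mathfrak{a}=\mathfrak{f}+(G)$, $\mathfrak{f}$ generated by a homogeneous regular sequence of degrees $d_1\le\cdots\le d_h$, $G$ homogeneous of degree $D$, $G\notin\mathfrak{f}$. For $\mathbf{d}=(d_1,\ldots,d_h)$ and $E\le\sum(d_i-1)$, in $\overline{S}=\Bbbk[x_1,\ldots,x_h]$ let $U_E$ be the lex-largest monomial ($x_1>\cdots>x_h$) of degree $E$ not in $(\mathsf{x}^{\mathbf{d}})=(x_1^{d_1},\ldots,x_h^{d_h})$ and $\mathcal{L}(\mathbf{d};E)=(\mathsf{x}^{\mathbf{d}})+(U_E)$. With $\sigma=\sum_{i=1}^h(d_i-1)$, define $\varphi_m=\operatorname{HF}(\overline{S}/(\mathsf{x}^{\mathbf{d}});m)-\operatorname{HF}(\overline{S}/\mathcal{L}(\mathbf{d};m-1);m)$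 if $2\le m\le\sigma$, and $\varphi_m=0$ otherwise. Sums $\sum_{m=i}^j$ with $j<i$ are $0$. *)

theory Defs
  imports Main "HOL.Vector_Spaces" "HOL-Library.Poly_Mapping"
begin

text \<open>Polynomials over a field 'k in variables x_0, x_1, ... (monomials = exponent
vectors).  The ring S = k[x_1..x_n] is the set of polynomials
involving only the variables with index < n (index i here = variable x_(i+1)).\<close>

type_synonym 'k mpoly = "(nat \<Rightarrow>\<^sub>0 nat) \<Rightarrow>\<^sub>0 'k"

definition mdeg :: "(nat \<Rightarrow>\<^sub>0 nat) \<Rightarrow> nat" where
  "mdeg \<alpha> = (\<Sum>i\<in>Poly_Mapping.keys \<alpha>. Poly_Mapping.lookup \<alpha> i)"

definition mvars_in :: "nat \<Rightarrow> (nat \<Rightarrow>\<^sub>0 nat) \<Rightarrow> bool" where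
  "mvars_in n \<alpha> \<longleftrightarrow> (\<forall>i. n \<le> i \<longrightarrow> Poly_Mapping.lookup \<alpha> i = 0)"

definition polyring :: "nat \<Rightarrow> 'k::field mpoly set" where
  "polyring n = {p. \<forall>\<alpha>\<in>Poly_Mapping.keys p. mvars_in n \<alpha>}"

definition hom_comp :: "nat \<Rightarrow> nat \<Rightarrow> 'k::field mpoly set" where
  "hom_comp n j = {p \<in> polyring n. \<forall>\<alpha>\<in>Poly_Mapping.keys p. mdeg \<alpha> = j}"

definition homogeneous :: "nat \<Rightarrow> nat \<Rightarrow> 'k::field mpoly \<Rightarrow> bool" where
  "homogeneous n j p \<longleftrightarrow> p \<in> hom_comp n j"

definition ideal_gen :: "nat \<Rightarrow> 'k::field mpoly set \<Rightarrow> 'k mpoly set" where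
  "ideal_gen n B = {p. \<exists>B' r. finite B' \<and> B' \<subseteq> B \<and> (\<forall>b\<in>B'. r b \<in> polyring n)
                        \<and> p = (\<Sum>b\<in>B'. r b * b)}"

definition kscale :: "'k::field \<Rightarrow> 'k mpoly \<Rightarrow> 'k mpoly" where
  "kscale c p = Poly_Mapping.map (\<lambda>a. c * a) p"

definition kdim :: "'k::field mpoly set \<Rightarrow> nat" where
  "kdim V = vector_space.dim kscale V"

text \<open>Hilbert function of S/I in degree j: dim_k (S_j / I_j) = dim_k S_j - dim_k (I \<inter> S_j).\<close>
definition HF_quot :: "nat \<Rightarrow> 'k::field mpoly set \<Rightarrow> nat \<Rightarrow> nat" where
  "HF_quot n I j = kdim (hom_comp n j :: 'k mpoly set) - kdim (I \<inter> hom_comp n j)"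

text \<open>Artinian (for a homogeneous ideal): S/I is finite dimensional over k,
i.e. its Hilbert function vanishes in all large degrees.\<close>
definition artinian_quot :: "nat \<Rightarrow> 'k::field mpoly set \<Rightarrow> bool" where
  "artinian_quot n I \<longleftrightarrow> (\<exists>N. \<forall>j\<ge>N. HF_quot n I j = 0)"

text \<open>Multiplicity of an Artinian graded quotient = its length = dim_k (S/I)
= \<Sum>_j HF(S/I; j).\<close>
definition mult_quot :: "nat \<Rightarrow> 'k::field mpoly set \<Rightarrow> nat" where
  "mult_quot n I = (\<Sum>j < (LEAST N. \<forall>j\<ge>N. HF_quot n I j = 0). HF_quot n I j)"

definition regular_sequence :: "nat \<Rightarrow> nat \<Rightarrow> (nat \<Rightarrow> 'k::field mpoly) \<Rightarrow> bool" where
  "regular_sequence n h f \<longleftrightarrow>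
     (\<forall>i<h. f i \<in> polyring n) \<and>
     (1::'k mpoly) \<notin> ideal_gen n (f ` {..<h}) \<and>
     (\<forall>i<h. \<forall>r\<in>polyring n. r * f i \<in> ideal_gen n (f ` {..<i}) \<longrightarrow> r \<in> ideal_gen n (f ` {..<i}))"

definition monom :: "(nat \<Rightarrow>\<^sub>0 nat) \<Rightarrow> 'k::field mpoly" where
  "monom \<alpha> = Poly_Mapping.single \<alpha> 1"

definition varpow :: "nat \<Rightarrow> nat \<Rightarrow> 'k::field mpoly" where
  "varpow i e = monom (Poly_Mapping.single i e)"

definition pow_ideal :: "nat \<Rightarrow> (nat \<Rightarrow> nat) \<Rightarrow> 'k::field mpoly set" where
  "pow_ideal n d = ideal_gen n ((\<lambda>i. varpow i (d i)) ` {..<n})"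

definition lex_gt :: "(nat \<Rightarrow>\<^sub>0 nat) \<Rightarrow> (nat \<Rightarrow>\<^sub>0 nat) \<Rightarrow> bool" where
  "lex_gt \<alpha> \<beta> \<longleftrightarrow> (\<exists>i. Poly_Mapping.lookup \<beta> i < Poly_Mapping.lookup \<alpha> i \<and> (\<forall>j<i. Poly_Mapping.lookup \<alpha> j = Poly_Mapping.lookup \<beta> j))"

definition U_exp :: "'k::field itself \<Rightarrow> nat \<Rightarrow> (nat \<Rightarrow> nat) \<Rightarrow> nat \<Rightarrow> (nat \<Rightarrow>\<^sub>0 nat)" where
  "U_exp _ n d E = (THE \<alpha>. mvars_in n \<alpha> \<and> mdeg \<alpha> = E \<and> (monom \<alpha> :: 'k mpoly) \<notin> pow_ideal n d \<and>
      (\<forall>\<beta>. mvars_in n \<beta> \<and> mdeg \<beta> = E \<and> (monom \<beta> :: 'k mpoly) \<notin> pow_ideal n d \<and> \<beta> \<noteq> \<alpha>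
            \<longrightarrow> lex_gt \<alpha> \<beta>))"

definition sigma :: "nat \<Rightarrow> (nat \<Rightarrow> nat) \<Rightarrow> nat" where
  "sigma n d = (\<Sum>i<n. d i - 1)"

definition lex_L :: "nat \<Rightarrow> (nat \<Rightarrow> nat) \<Rightarrow> nat \<Rightarrow> 'k::field mpoly set" where
  "lex_L n d E = ideal_gen n ((\<lambda>i. varpow i (d i)) ` {..<n} \<union> {monom (U_exp TYPE('k) n d E)})"

definition phi :: "'k::field itself \<Rightarrow> nat \<Rightarrow> (nat \<Rightarrow> nat) \<Rightarrow> nat \<Rightarrow> int" where
  "phi _ n d m = (if 2 \<le> m \<and> m \<le> sigma n d
     then int (HF_quot n (pow_ideal n d :: 'k mpoly set) m) - int (HF_quot n (lex_L n d (m - 1) :: 'k mpoly set) m)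
     else 0)"

end

theory Submission
  imports Defs "HOL-Library.FuncSet"
begin

text \<open>Let \<open>G \<notin> (f)\<close> have degree \<open>e\<close> and let \<open>w\<close> independent linear forms annihilate it modulo \<open>(f)\<close>.  Then \<open>G\<close>
  is a nonzero class in \<open>Tor\<^sub>w(S/(l), S/(f))\<close>, which by the Koszul complex of \<open>f\<close> lives in degrees at
  least \<open>d\<^sub>1 + \<dots> + d\<^sub>w\<close>, so \<open>e + w \<ge> d\<^sub>1 + \<dots> + d\<^sub>w\<close>.  On the monomial side this is exactly the condition under
  which the lex-largest monomial \<open>U\<^sub>e\<close> has its first \<open>w\<close> exponents maximal, so that at most \<open>n - w\<close> of its
  multiples \<open>x\<^sub>i U\<^sub>e\<close> survive: \<open>\<phi>\<close> in degree \<open>e + 1\<close> is at most \<open>n - w\<close>, while \<open>G\<close> adds \<open>n - w\<close> dimensions to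
  \<open>(f)\<close> there.  The case \<open>w = n\<close> says that the socle of \<open>S/(f)\<close> starts in degree \<open>\<sigma>\<close>, so \<open>G\<close> has a multiple outside
  \<open>(f)\<close> in every degree up to \<open>\<sigma>\<close>, and the bound applies in each of them.\<close>

section \<open>Monomials and graded pieces\<close>

text \<open>Since S/(f) and S/(x^d) have the same Hilbert function, it suffices that enlarging (f)
  by a form of degree m - 1 gains at least as many dimensions in degree m as enlarging the monomial
  ideal by the lex monomial does. The obstacle is that the gain n - w depends on the unknown f and
  G; the numerical inequality on w carries it over to the monomial side. The Tor class is G times
  the top basis element of the Koszul complex of the linear forms. It is a cycle modulo (f) of total
  degree e + w, and it is a boundary modulo (f) only if G lies in (f), since there are no chains
  above it. The degree bound comes from the w-th Koszul module of f, generated in degrees that are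
  sums of w distinct d_i; as d is sorted, the first w give the smallest sum. Neither Tor nor a
  double complex is formed: the interchange of the two Koszul complexes is unrolled into an
  induction along f, one long exact sequence per element.\<close>

abbreviation lk :: "('a \<Rightarrow>\<^sub>0 'b::zero) \<Rightarrow> 'a \<Rightarrow> 'b" where
  "lk \<equiv> Poly_Mapping.lookup"

abbreviation keys :: "('a \<Rightarrow>\<^sub>0 'b::zero) \<Rightarrow> 'a set" where
  "keys \<equiv> Poly_Mapping.keys"

lemma mdeg_superset:
  assumes "finite A" "keys \<alpha> \<subseteq> A"
  shows "mdeg \<alpha> = (\<Sum>i\<in>A. lk \<alpha> i)"
  unfolding mdeg_def using assms
  by (intro sum.mono_neutral_left) (auto simp: in_keys_iff)

lemma mdeg_add: "mdeg (\<alpha> + \<beta>) = mdeg \<alpha> + mdeg \<beta>"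
proof -
  let ?A = "keys \<alpha> \<union> keys \<beta>"
  have k: "keys (\<alpha> + \<beta>) \<subseteq> ?A" by (rule keys_add)
  show ?thesis
    using mdeg_superset[of ?A "\<alpha> + \<beta>"] mdeg_superset[of ?A \<alpha>] mdeg_superset[of ?A \<beta>] k
    by (simp add: lookup_add sum.distrib)
qed

lemma mdeg_single [simp]: "mdeg (Poly_Mapping.single i e) = e"
  by (cases "e = 0") (auto simp: mdeg_def)

lemma mdeg_zero [simp]: "mdeg 0 = 0"
  by (simp add: mdeg_def)

lemma mdeg_eq_0_iff: "mdeg \<alpha> = 0 \<longleftrightarrow> \<alpha> = 0"
  by (auto simp: mdeg_def in_keys_iff intro: poly_mapping_eqI)

lemma mdeg_eq_1E:
  assumes "mdeg \<alpha> = 1"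
  obtains i where "\<alpha> = Poly_Mapping.single i (Suc 0)"
proof -
  have "\<alpha> \<noteq> 0" using assms mdeg_eq_0_iff[of \<alpha>] by simp
  then obtain i where i: "i \<in> keys \<alpha>" by (metis ex_in_conv keys_eq_empty)
  let ?e = "Poly_Mapping.single i (Suc 0)"
  have eq: "\<alpha> = ?e + (\<alpha> - ?e)"
    using i by (intro poly_mapping_eqI) (auto simp: lookup_add lookup_minus lookup_single in_keys_iff when_def)
  have "mdeg \<alpha> = 1 + mdeg (\<alpha> - ?e)" by (subst eq) (simp only: mdeg_add mdeg_single One_nat_def)
  then have "\<alpha> - ?e = 0" using assms mdeg_eq_0_iff[of "\<alpha> - ?e"] by simp
  then have "\<alpha> = ?e" using eq by (metis add.right_neutral)
  then show ?thesis by (rule that)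
qed

lemma mvars_in_add [simp]: "mvars_in n (\<alpha> + \<beta>) \<longleftrightarrow> mvars_in n \<alpha> \<and> mvars_in n \<beta>"
  by (auto simp: mvars_in_def lookup_add)

lemma mvars_in_zero [simp]: "mvars_in n 0"
  by (simp add: mvars_in_def)

lemma mvars_in_single [simp]: "mvars_in n (Poly_Mapping.single i e) \<longleftrightarrow> i < n \<or> e = 0"
  by (auto simp: mvars_in_def lookup_single when_def)

lemma mvars_in_keys: "mvars_in n \<alpha> \<longleftrightarrow> keys \<alpha> \<subseteq> {..<n}"
  unfolding mvars_in_def subset_iff in_keys_iff lessThan_iff by (meson not_less)

lemma mdeg_mvars: "mvars_in n \<alpha> \<Longrightarrow> mdeg \<alpha> = (\<Sum>i<n. lk \<alpha> i)"
  by (auto simp: mvars_in_keys intro: mdeg_superset)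

lemma finite_monomials: "finite {\<alpha>. mvars_in n \<alpha> \<and> mdeg \<alpha> = j}"
proof (rule inj_on_finite)
  show "inj_on (\<lambda>\<alpha>. map (lk \<alpha>) [0..<n]) {\<alpha>. mvars_in n \<alpha> \<and> mdeg \<alpha> = j}"
  proof (rule inj_onI)
    fix \<alpha> \<beta>
    assume "\<alpha> \<in> {\<alpha>. mvars_in n \<alpha> \<and> mdeg \<alpha> = j}" "\<beta> \<in> {\<alpha>. mvars_in n \<alpha> \<and> mdeg \<alpha> = j}"
      and eq: "map (lk \<alpha>) [0..<n] = map (lk \<beta>) [0..<n]"
    then have "lk \<alpha> i = lk \<beta> i" if "i < n" for i using that by simp
    moreover have "lk \<alpha> i = lk \<beta> i" if "\<not> i < n" for i
      using that \<open>\<alpha> \<in> _\<close> \<open>\<beta> \<in> _\<close> by (simp add: mvars_in_def not_less)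
    ultimately have "lk \<alpha> i = lk \<beta> i" for i by blast
    then show "\<alpha> = \<beta>" by (rule poly_mapping_eqI)
  qed
  show "(\<lambda>\<alpha>. map (lk \<alpha>) [0..<n]) ` {\<alpha>. mvars_in n \<alpha> \<and> mdeg \<alpha> = j}
      \<subseteq> {xs. set xs \<subseteq> {..j} \<and> length xs = n}"
    by (auto simp: mdeg_mvars intro!: member_le_sum)
  show "finite {xs::nat list. set xs \<subseteq> {..j} \<and> length xs = n}"
    by (rule finite_lists_length_eq) simp
qed

lemma keys_uminus' [simp]: "keys (- p) = keys (p :: 'a \<Rightarrow>\<^sub>0 'k::ab_group_add)"
  by (auto simp: in_keys_iff)

lemma keys_diff': "keys (p - q) \<subseteq> keys p \<union> keys (q :: 'a \<Rightarrow>\<^sub>0 'k::ab_group_add)"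
  by (auto simp: in_keys_iff lookup_minus)

lemma polyring_0 [simp]: "0 \<in> polyring n"
  by (simp add: polyring_def)

lemma polyring_1 [simp]: "1 \<in> polyring n"
  by (simp add: polyring_def)

lemma polyring_add [simp]: "p \<in> polyring n \<Longrightarrow> q \<in> polyring n \<Longrightarrow> p + q \<in> polyring n"
  using keys_add[of p q] by (auto simp: polyring_def)

lemma polyring_uminus [simp]: "- p \<in> polyring n \<longleftrightarrow> p \<in> polyring n"
  by (auto simp: polyring_def)

lemma polyring_diff [simp]: "p \<in> polyring n \<Longrightarrow> q \<in> polyring n \<Longrightarrow> p - q \<in> polyring n"
  using keys_diff'[of p q] by (auto simp: polyring_def)

lemma polyring_mult [simp]: "p \<in> polyring n \<Longrightarrow> q \<in> polyring n \<Longrightarrow> p * q \<in> polyring n"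
  using keys_mult[of p q] by (fastforce simp: polyring_def)

lemma polyring_sum: "(\<And>x. x \<in> A \<Longrightarrow> g x \<in> polyring n) \<Longrightarrow> sum g A \<in> polyring n"
  by (induction A rule: infinite_finite_induct) auto

lemma polyring_prod: "(\<And>x. x \<in> A \<Longrightarrow> g x \<in> polyring n) \<Longrightarrow> prod g A \<in> polyring n"
  by (induction A rule: infinite_finite_induct) auto

lemma polyring_power: "p \<in> polyring n \<Longrightarrow> p ^ e \<in> polyring n"
  by (induction e) auto

lemma polyring_single: "mvars_in n \<alpha> \<Longrightarrow> Poly_Mapping.single \<alpha> c \<in> polyring n"
  by (simp add: polyring_def)

lemma polyring_monom: "mvars_in n \<alpha> \<Longrightarrow> monom \<alpha> \<in> polyring n"
  by (simp add: monom_def polyring_single)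

lemma monom_mult: "monom \<alpha> * monom \<beta> = monom (\<alpha> + \<beta>)"
  by (simp add: monom_def mult_single)

lemma keys_monom [simp]: "keys (monom \<alpha> :: 'k::field mpoly) = {\<alpha>}"
  by (simp add: monom_def)

lemma inj_monom: "inj (monom :: _ \<Rightarrow> 'k::field mpoly)"
  by (rule injI) (metis keys_monom singleton_inject)

text \<open>Degrees are taken in \<^typ>\<open>int\<close>, so that shifting below degree zero yields the zero space.\<close>

definition hom_int :: "nat \<Rightarrow> int \<Rightarrow> 'k::field mpoly set" where
  "hom_int n e = {p \<in> polyring n. \<forall>\<alpha>\<in>keys p. int (mdeg \<alpha>) = e}"

lemma hom_int_of_nat: "hom_int n (int e) = hom_comp n e"
  by (auto simp: hom_int_def hom_comp_def)

lemma hom_int_neg: "p \<in> hom_int n e \<Longrightarrow> e < 0 \<Longrightarrow> p = 0"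
  by (force simp: hom_int_def simp flip: keys_eq_empty)

lemma hom_int_polyring: "p \<in> hom_int n e \<Longrightarrow> p \<in> polyring n"
  by (simp add: hom_int_def)

lemma hom_int_0 [simp]: "0 \<in> hom_int n e"
  by (simp add: hom_int_def)

lemma hom_int_add: "p \<in> hom_int n e \<Longrightarrow> q \<in> hom_int n e \<Longrightarrow> p + q \<in> hom_int n e"
  using keys_add[of p q] by (auto simp: hom_int_def)

lemma hom_int_uminus: "p \<in> hom_int n e \<Longrightarrow> - p \<in> hom_int n e"
  by (auto simp: hom_int_def)

lemma hom_int_diff: "p \<in> hom_int n e \<Longrightarrow> q \<in> hom_int n e \<Longrightarrow> p - q \<in> hom_int n e"
  using keys_diff'[of p q] by (auto simp: hom_int_def)

lemma hom_int_mult: "p \<in> hom_int n a \<Longrightarrow> q \<in> hom_int n b \<Longrightarrow> p * q \<in> hom_int n (a + b)"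
  using keys_mult[of p q] by (fastforce simp: hom_int_def mdeg_add)

lemma hom_comp_mult: "p \<in> hom_comp n a \<Longrightarrow> q \<in> hom_comp n b \<Longrightarrow> p * q \<in> hom_comp n (a + b)"
  using hom_int_mult[of p n "int a" q "int b"] by (simp add: hom_int_of_nat flip: of_nat_add)

lemma hom_comp_monom: "mvars_in n \<alpha> \<Longrightarrow> monom \<alpha> \<in> hom_comp n (mdeg \<alpha>)"
  by (simp add: hom_comp_def polyring_monom)

section \<open>Homogeneous components\<close>

definition hpart :: "int \<Rightarrow> 'k::field mpoly \<Rightarrow> 'k mpoly" where
  "hpart e p = Poly_Mapping.mapp (\<lambda>\<alpha> v. v when int (mdeg \<alpha>) = e) p"

lemma lookup_hpart: "lk (hpart e p) \<alpha> = (lk p \<alpha> when int (mdeg \<alpha>) = e)"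
  by (auto simp: hpart_def lookup_mapp when_def in_keys_iff)

lemma hpart_add: "hpart e (p + q) = hpart e p + hpart e q"
  by (rule poly_mapping_eqI) (auto simp: lookup_hpart lookup_add when_def)

lemma hpart_uminus: "hpart e (- p) = - hpart e p"
  by (rule poly_mapping_eqI) (auto simp: lookup_hpart when_def)

lemma hpart_diff: "hpart e (p - q) = hpart e p - hpart e q"
  by (rule poly_mapping_eqI) (auto simp: lookup_hpart lookup_minus when_def)

lemma hpart_0 [simp]: "hpart e 0 = 0"
  by (rule poly_mapping_eqI) (auto simp: lookup_hpart)

lemma hpart_polyring: "p \<in> polyring n \<Longrightarrow> hpart e p \<in> polyring n"
  by (auto simp: polyring_def in_keys_iff lookup_hpart)

lemma hpart_in_hom_int: "p \<in> polyring n \<Longrightarrow> hpart e p \<in> hom_int n e"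
  by (auto simp: hom_int_def hpart_polyring in_keys_iff lookup_hpart)

lemma hpart_id: "p \<in> hom_int n e \<Longrightarrow> hpart e p = p"
  by (rule poly_mapping_eqI) (force simp: hom_int_def lookup_hpart when_def in_keys_iff)

lemma hpart_eq_0: "(\<And>\<alpha>. \<alpha> \<in> keys p \<Longrightarrow> int (mdeg \<alpha>) \<noteq> e) \<Longrightarrow> hpart e p = 0"
  by (rule poly_mapping_eqI) (auto simp: lookup_hpart when_def in_keys_iff)

text \<open>Removing from \<open>q\<close> its component of degree \<open>e - d\<close> leaves a
  product with no term in degree \<open>e\<close>. With integer degrees the formula also covers
  \<open>e < d\<close>, where the right side is 0.\<close>

lemma hpart_mult:
  assumes "f \<in> hom_int n d"
  shows "hpart e (f * q) = f * hpart (e - d) q"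
proof -
  define r where "r = q - hpart (e - d) q"
  have "int (mdeg \<alpha>) \<noteq> e - d" if "\<alpha> \<in> keys r" for \<alpha>
    using that by (auto simp: r_def in_keys_iff lookup_minus lookup_hpart when_def split: if_splits)
  then have "int (mdeg \<alpha>) \<noteq> e" if "\<alpha> \<in> keys (f * r)" for \<alpha>
    using that keys_mult[of f r] assms by (fastforce simp: hom_int_def mdeg_add)
  then have 1: "hpart e (f * r) = 0" by (intro hpart_eq_0)
  have "int (mdeg \<alpha>) = e" if "\<alpha> \<in> keys (f * hpart (e - d) q)" for \<alpha>
    using that keys_mult[of f "hpart (e - d) q"] assms
    by (fastforce simp: hom_int_def mdeg_add in_keys_iff lookup_hpart)
  then have 2: "hpart e (f * hpart (e - d) q) = f * hpart (e - d) q"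
    by (intro poly_mapping_eqI) (auto simp: lookup_hpart when_def in_keys_iff)
  have "f * q = f * r + f * hpart (e - d) q" by (simp add: r_def algebra_simps)
  then show ?thesis by (simp only: hpart_add 1 2) simp
qed

section \<open>Ideals\<close>

definition is_ideal :: "nat \<Rightarrow> 'k::field mpoly set \<Rightarrow> bool" where
  "is_ideal n I \<longleftrightarrow> I \<subseteq> polyring n \<and> 0 \<in> I \<and> (\<forall>p\<in>I. \<forall>q\<in>I. p + q \<in> I)
    \<and> (\<forall>r\<in>polyring n. \<forall>p\<in>I. r * p \<in> I)"

lemma is_idealI:
  assumes "\<And>p. p \<in> I \<Longrightarrow> p \<in> polyring n" "0 \<in> I" "\<And>p q. p \<in> I \<Longrightarrow> q \<in> I \<Longrightarrow> p + q \<in> I"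
    "\<And>r p. r \<in> polyring n \<Longrightarrow> p \<in> I \<Longrightarrow> r * p \<in> I"
  shows "is_ideal n I"
  using assms by (auto simp: is_ideal_def)

lemma is_idealD:
  assumes "is_ideal n I"
  shows ideal_polyring: "p \<in> I \<Longrightarrow> p \<in> polyring n"
    and ideal_0: "0 \<in> I"
    and ideal_add: "p \<in> I \<Longrightarrow> q \<in> I \<Longrightarrow> p + q \<in> I"
    and ideal_mult: "r \<in> polyring n \<Longrightarrow> p \<in> I \<Longrightarrow> r * p \<in> I"
    and ideal_mult2: "r \<in> polyring n \<Longrightarrow> p \<in> I \<Longrightarrow> p * r \<in> I"
  using assms by (auto simp: is_ideal_def mult.commute)

lemma ideal_uminus:
  assumes "is_ideal n I" "p \<in> I"
  shows "- p \<in> I"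
  using ideal_mult[OF assms(1) _ assms(2), of "- 1"] by simp

lemma ideal_sum:
  assumes "is_ideal n I" "\<And>x. x \<in> A \<Longrightarrow> g x \<in> I"
  shows "sum g A \<in> I"
  using assms(2) by (induction A rule: infinite_finite_induct)
    (auto intro: ideal_add[OF assms(1)] ideal_0[OF assms(1)])

lemma ideal_gen_least:
  assumes "is_ideal n I" "B \<subseteq> I"
  shows "ideal_gen n B \<subseteq> I"
  using assms by (auto simp: ideal_gen_def intro!: ideal_sum ideal_mult[OF assms(1)])

lemma is_ideal_gen:
  assumes "B \<subseteq> polyring n"
  shows "is_ideal n (ideal_gen n B)"
proof (rule is_idealI)
  fix p assume "p \<in> ideal_gen n B"
  then show "p \<in> polyring n" using assms by (auto simp: ideal_gen_def intro!: polyring_sum polyring_mult)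
next
  show "0 \<in> ideal_gen n B" by (auto simp: ideal_gen_def intro!: exI[of _ "{}"])
next
  fix p q assume "p \<in> ideal_gen n B" "q \<in> ideal_gen n B"
  then obtain P r Q s where P: "finite P" "P \<subseteq> B" "\<forall>b\<in>P. r b \<in> polyring n" "p = (\<Sum>b\<in>P. r b * b)"
    and Q: "finite Q" "Q \<subseteq> B" "\<forall>b\<in>Q. s b \<in> polyring n" "q = (\<Sum>b\<in>Q. s b * b)"
    unfolding ideal_gen_def by blast
  let ?r = "\<lambda>b. (if b \<in> P then r b else 0) + (if b \<in> Q then s b else 0)"
  have "p = (\<Sum>b\<in>P \<union> Q. (if b \<in> P then r b else 0) * b)"
    unfolding P(4) using P(1) Q(1) by (intro sum.mono_neutral_cong_left) auto
  moreover have "q = (\<Sum>b\<in>P \<union> Q. (if b \<in> Q then s b else 0) * b)"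
    unfolding Q(4) using P(1) Q(1) by (intro sum.mono_neutral_cong_left) auto
  ultimately have "p + q = (\<Sum>b\<in>P \<union> Q. ?r b * b)"
    by (simp add: distrib_right sum.distrib)
  then show "p + q \<in> ideal_gen n B"
    using P Q unfolding ideal_gen_def
    by (intro CollectI exI[of _ "P \<union> Q"] exI[of _ ?r]) auto
next
  fix t p :: "'a mpoly" assume t: "t \<in> polyring n" and "p \<in> ideal_gen n B"
  then obtain P r where P: "finite P" "P \<subseteq> B" "\<forall>b\<in>P. r b \<in> polyring n" "p = (\<Sum>b\<in>P. r b * b)"
    unfolding ideal_gen_def by blast
  then show "t * p \<in> ideal_gen n B"
    using t unfolding ideal_gen_def
    by (intro CollectI exI[of _ P] exI[of _ "\<lambda>b. t * r b"]) (auto simp: sum_distrib_left mult.assoc)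
qed

lemma ideal_gen_base: "b \<in> B \<Longrightarrow> b \<in> ideal_gen n B"
  unfolding ideal_gen_def
  by (rule CollectI, rule exI[of _ "{b}"], rule exI[of _ "\<lambda>_. 1"]) simp

lemma ideal_gen_mono: "B \<subseteq> C \<Longrightarrow> ideal_gen n B \<subseteq> ideal_gen n C"
  unfolding ideal_gen_def by blast

lemma ideal_gen_empty [simp]: "ideal_gen n {} = {0}"
  by (auto simp: ideal_gen_def)

text \<open>Splits off the coefficient of one generator, the form in which the inductions along
  \<open>l\<close> and \<open>f\<close> meet the last element.\<close>

lemma ideal_gen_insert:
  assumes "B \<subseteq> polyring n" "g \<in> polyring n"
  shows "p \<in> ideal_gen n (insert g B) \<longleftrightarrow> (\<exists>u\<in>ideal_gen n B. \<exists>v\<in>polyring n. p = u + g * v)"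
proof
  note B = is_ideal_gen[OF assms(1)]
  let ?I = "{p. \<exists>u\<in>ideal_gen n B. \<exists>v\<in>polyring n. p = u + g * v}"
  have "is_ideal n ?I"
  proof (rule is_idealI)
    show "p \<in> polyring n" if "p \<in> ?I" for p
      using that assms by (auto intro!: polyring_add polyring_mult dest: ideal_polyring[OF B])
    show "0 \<in> ?I" using ideal_0[OF B] by (auto intro!: bexI[of _ 0])
    show "p + q \<in> ?I" if "p \<in> ?I" "q \<in> ?I" for p q
    proof -
      from that obtain u v u' v' where "u \<in> ideal_gen n B" "v \<in> polyring n" "p = u + g * v"
        "u' \<in> ideal_gen n B" "v' \<in> polyring n" "q = u' + g * v'" by auto
      then show ?thesis
        by (intro CollectI bexI[of _ "u + u'"] bexI[of _ "v + v'"])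
           (auto simp: algebra_simps intro: ideal_add[OF B])
    qed
    show "r * p \<in> ?I" if "r \<in> polyring n" "p \<in> ?I" for r p
    proof -
      from that obtain u v where "u \<in> ideal_gen n B" "v \<in> polyring n" "p = u + g * v" by auto
      then show ?thesis using that(1)
        by (intro CollectI bexI[of _ "r * u"] bexI[of _ "r * v"])
           (auto simp: algebra_simps intro: ideal_mult[OF B])
    qed
  qed
  moreover have "insert g B \<subseteq> ?I"
  proof
    fix b assume "b \<in> insert g B"
    then consider "b = g" | "b \<in> B" by blast
    then show "b \<in> ?I"
    proof cases
      case 1
      then show ?thesis using ideal_0[OF B] by (intro CollectI bexI[of _ 0] bexI[of _ 1]) auto
    next
      case 2
      then show ?thesis using ideal_gen_base[OF 2]
        by (intro CollectI bexI[of _ b] bexI[of _ 0]) auto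
    qed
  qed
  ultimately have "ideal_gen n (insert g B) \<subseteq> ?I" by (rule ideal_gen_least)
  then show "\<exists>u\<in>ideal_gen n B. \<exists>v\<in>polyring n. p = u + g * v" if "p \<in> ideal_gen n (insert g B)"
    using that by blast
  have B': "is_ideal n (ideal_gen n (insert g B))" using assms by (intro is_ideal_gen) auto
  show "p \<in> ideal_gen n (insert g B)" if "\<exists>u\<in>ideal_gen n B. \<exists>v\<in>polyring n. p = u + g * v"
    using that ideal_gen_mono[of B "insert g B" n] ideal_gen_base[of g "insert g B" n]
    by (auto intro!: ideal_add[OF B'] ideal_mult2[OF B'])
qed

text \<open>Homogeneous generators make the ideal graded, because \<open>hpart\<close> of a summand
  only replaces its coefficient by a component. Memberships can therefore be cut down to one
  degree.\<close>

lemma hpart_ideal_gen: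
  assumes "B \<subseteq> polyring n" "\<And>b. b \<in> B \<Longrightarrow> \<exists>d. b \<in> hom_int n d" "p \<in> ideal_gen n B"
  shows "hpart e p \<in> ideal_gen n B"
proof -
  note B = is_ideal_gen[OF assms(1)]
  obtain P r where P: "finite P" "P \<subseteq> B" "\<forall>b\<in>P. r b \<in> polyring n" "p = (\<Sum>b\<in>P. r b * b)"
    using assms(3) unfolding ideal_gen_def by blast
  have "hpart e (sum (\<lambda>b. r b * b) P) = (\<Sum>b\<in>P. hpart e (r b * b))"
    by (induction P rule: infinite_finite_induct) (auto simp: hpart_add)
  also have "\<dots> \<in> ideal_gen n B"
  proof (rule ideal_sum[OF B])
    fix b assume b: "b \<in> P"
    then obtain d where d: "b \<in> hom_int n d" using assms(2) P(2) by blast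
    have "hpart e (r b * b) = hpart (e - d) (r b) * b"
      using hpart_mult[OF d, of e "r b"] by (simp add: mult.commute)
    moreover have "b \<in> ideal_gen n B" using b P by (intro ideal_gen_base) auto
    ultimately show "hpart e (r b * b) \<in> ideal_gen n B"
      using b P by (auto intro!: ideal_mult[OF B] hpart_polyring)
  qed
  finally show ?thesis by (simp add: P(4))
qed

section \<open>The Koszul complex\<close>

text \<open>Chains are functions on finite sets of indices; \<^term>\<open>c B\<close> is the coefficient of the basis
  element indexed by \<^term>\<open>B\<close>.  Passing the largest index contributes a sign, so that the complex on
  \<^term>\<open>Suc w\<close> elements is the mapping cone of multiplication by \<^term>\<open>l w\<close> on the complex on
  \<^term>\<open>w\<close> elements.\<close>

primrec kos :: "(nat \<Rightarrow> 'k::field mpoly) \<Rightarrow> nat \<Rightarrow> (nat set \<Rightarrow> 'k mpoly) \<Rightarrow> nat set \<Rightarrow> 'k mpoly" where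
  "kos l 0 c B = 0"
| "kos l (Suc w) c B = (if w \<in> B then - kos l w c B else kos l w c B + l w * c (insert w B))"

text \<open>The value at \<open>B\<close> reads the chain only at sets with one more index below
  \<open>w\<close>. In particular the value of a chain at the empty set is never read.\<close>

lemma kos_cong:
  assumes "\<And>i. i < w \<Longrightarrow> i \<notin> B \<Longrightarrow> c (insert i B) = c' (insert i B)"
  shows "kos l w c B = kos l w c' B"
  using assms by (induction w) auto

lemma kos_0 [simp]: "kos l w (\<lambda>_. 0) B = 0"
  by (induction w) auto

lemma kos_add: "kos l w (\<lambda>B. c B + c' B) B = kos l w c B + kos l w c' B"
  by (induction w) (auto simp: algebra_simps)

lemma kos_mult: "kos l w (\<lambda>B. r * c B) B = r * kos l w c B"
  by (induction w) (auto simp: algebra_simps)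

lemma kos_uminus: "kos l w (\<lambda>B. - c B) B = - kos l w c B"
  using kos_mult[of l w "- 1" c B] by simp

lemma kos_diff: "kos l w (\<lambda>B. c B - c' B) B = kos l w c B - kos l w c' B"
  using kos_add[of l w c "\<lambda>B. - c' B" B] by (simp add: kos_uminus)

text \<open>An index at or above \<open>w\<close> is neither tested nor inserted by
  \<open>kos l w\<close>, so it is carried along without a sign.\<close>

lemma kos_insert:
  assumes "w \<le> v"
  shows "kos l w c (insert v B) = kos l w (\<lambda>A. c (insert v A)) B"
  using assms by (induction w) (auto simp: insert_commute)

text \<open>The sign on sets containing \<open>w\<close> makes the two mixed terms cancel; each is
  \<open>l w\<close> times the smaller differential of the part containing \<open>w\<close>.\<close>

lemma kos_kos: "kos l w (kos l w c) B = 0"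
proof (induction w arbitrary: c B)
  case (Suc w)
  show ?case
  proof (cases "w \<in> B")
    case True
    have "kos l w (kos l (Suc w) c) B = kos l w (\<lambda>A. - kos l w c A) B"
      by (rule kos_cong) (use True in auto)
    then have "kos l w (kos l (Suc w) c) B = 0" using Suc by (simp only: kos_uminus) simp
    then show ?thesis using True by (subst kos.simps(2)) simp
  next
    case False
    have "kos l w (kos l (Suc w) c) B = kos l w (\<lambda>A. kos l w c A + l w * c (insert w A)) B"
      by (rule kos_cong) (use False in auto)
    then have "kos l w (kos l (Suc w) c) B = l w * kos l w (\<lambda>A. c (insert w A)) B"
      using Suc by (simp only: kos_add kos_mult) simp
    moreover have "kos l (Suc w) c (insert w B) = - kos l w (\<lambda>A. c (insert w A)) B"
      by (simp add: kos_insert)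
    ultimately show ?thesis using False by (subst kos.simps(2)) simp
  qed
qed simp

lemma kos_in_ideal:
  assumes "is_ideal n I" "\<And>i. i < w \<Longrightarrow> i \<notin> B \<Longrightarrow> l i * c (insert i B) \<in> I"
  shows "kos l w c B \<in> I"
  using assms(2)
  by (induction w) (auto intro: ideal_0[OF assms(1)] ideal_add[OF assms(1)] ideal_uminus[OF assms(1)])

lemma kos_polyring:
  assumes "\<And>i. i < w \<Longrightarrow> l i \<in> polyring n" "\<And>B. c B \<in> polyring n"
  shows "kos l w c B \<in> polyring n"
  using assms(1) by (induction w) (auto simp: assms(2))

lemma kos_hom_int:
  assumes "\<And>i. i < w \<Longrightarrow> l i \<in> hom_int n 1" "\<And>B. c B \<in> hom_int n e"
  shows "kos l w c B \<in> hom_int n (e + 1)"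
  using assms(1)
proof (induction w)
  case (Suc w)
  have "l w * c (insert w B) \<in> hom_int n (e + 1)"
    using hom_int_mult[OF Suc.prems[of w] assms(2)] by (simp add: add.commute)
  then show ?case using Suc by (auto intro: hom_int_add hom_int_uminus)
qed simp

text \<open>The chain \<^term>\<open>c\<close> need not be homogeneous: the condition on \<^term>\<open>c {}\<close> is the obstruction in homological
  degree zero.\<close>

lemma kos_exact:
  assumes "\<And>i. i < w \<Longrightarrow> l i \<in> polyring n"
    and "\<And>j r. j < w \<Longrightarrow> r \<in> polyring n \<Longrightarrow> r * l j \<in> ideal_gen n (l ` {..<j})
      \<Longrightarrow> r \<in> ideal_gen n (l ` {..<j})"
    and "\<And>B. c B \<in> polyring n"
    and "\<And>B. B \<subseteq> {..<w} \<Longrightarrow> kos l w c B = 0"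
    and "c {} \<in> ideal_gen n (l ` {..<w})"
  shows "\<exists>b. (\<forall>B. b B \<in> polyring n) \<and> (\<forall>B. B \<subseteq> {..<w} \<longrightarrow> c B = kos l w b B)"
  using assms
proof (induction w arbitrary: c)
  case 0
  then show ?case by (auto intro!: exI[of _ "\<lambda>_. 0"])
next
  case (Suc w)
  have lw: "l w \<in> polyring n" and lR: "l ` {..<w} \<subseteq> polyring n" using Suc.prems(1) by auto
  note J = is_ideal_gen[OF lR]
  have sub: "A \<subseteq> {..<Suc w}" "insert w A \<subseteq> {..<Suc w}" "w \<notin> A" if "A \<subseteq> {..<w}" for A
    using that by auto
  \<comment> \<open>\<open>c1\<close> is the part of \<open>c\<close> on sets containing
    \<open>w\<close>. The cycle condition splits in two: \<open>c1\<close> is itself a cycle, and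
    \<open>l w * c1\<close> is minus the smaller differential of \<open>c\<close>.\<close>
  define c1 where "c1 = (\<lambda>A. c (insert w A))"
  have kc1: "kos l w c A + l w * c1 A = 0" "kos l w c1 A = 0" if "A \<subseteq> {..<w}" for A
    using Suc.prems(4)[OF sub(1)[OF that]] Suc.prems(4)[OF sub(2)[OF that]] sub(3)[OF that]
    by (auto simp: c1_def kos_insert)
  \<comment> \<open>Regularity of \<open>l w\<close> turns \<open>c1 {} * l w\<close> in the smaller
    ideal into the degree-zero condition on \<open>c1\<close> that the induction hypothesis asks
    for.\<close>
  have "kos l w c {} \<in> ideal_gen n (l ` {..<w})"
    by (intro kos_in_ideal[OF J] ideal_mult2[OF J] ideal_gen_base Suc.prems) auto
  then have "c1 {} * l w \<in> ideal_gen n (l ` {..<w})"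
    using kc1(1)[of "{}"] ideal_uminus[OF J, of "kos l w c {}"]
    by (simp add: mult.commute add_eq_0_iff)
  then have c10: "c1 {} \<in> ideal_gen n (l ` {..<w})"
    using Suc.prems(2)[of w "c1 {}"] Suc.prems(3) by (simp add: c1_def)
  have c1R: "c1 B \<in> polyring n" for B using Suc.prems(3) by (simp add: c1_def)
  have lR': "l i \<in> polyring n" if "i < w" for i using Suc.prems(1) that by simp
  have reg: "r \<in> ideal_gen n (l ` {..<j})"
    if "j < w" "r \<in> polyring n" "r * l j \<in> ideal_gen n (l ` {..<j})" for j r
    using Suc.prems(2)[of j r] that by simp
  obtain b1 where b1: "\<And>B. b1 B \<in> polyring n" "\<And>A. A \<subseteq> {..<w} \<Longrightarrow> c1 A = kos l w b1 A"
    using Suc.IH[OF lR' reg c1R kc1(2) c10] by blast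
  have "c {} \<in> ideal_gen n (insert (l w) (l ` {..<w}))"
    using Suc.prems(5) by (simp add: lessThan_Suc)
  then obtain u s where us: "u \<in> ideal_gen n (l ` {..<w})" "s \<in> polyring n" "c {} = u + l w * s"
    using ideal_gen_insert[OF lR lw] by blast
  \<comment> \<open>The value at the empty set may be changed freely, since \<open>kos\<close> never
    reads it; \<open>- s\<close> is chosen so that \<open>c2 {}\<close> becomes \<open>u\<close>,
    which lies in the smaller ideal.\<close>
  define b2 where "b2 = b1({} := - s)"
  have b2R: "b2 B \<in> polyring n" for B using b1(1) us(2) by (simp add: b2_def)
  have b2: "kos l w b2 A = c1 A" if "A \<subseteq> {..<w}" for A
    using kos_cong[of w A b2 b1 l] b1(2)[OF that] by (simp add: b2_def)
  define c2 where "c2 = (\<lambda>A. c A + l w * b2 A)"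
  have kc2: "kos l w c2 A = 0" if "A \<subseteq> {..<w}" for A
    using kc1(1)[OF that] b2[OF that] by (simp add: c2_def kos_add kos_mult)
  have c20: "c2 {} \<in> ideal_gen n (l ` {..<w})"
    using us by (simp add: c2_def b2_def)
  have c2R: "c2 B \<in> polyring n" for B
    using Suc.prems(3) lw b2R by (simp add: c2_def)
  obtain b0 where b0: "\<And>B. b0 B \<in> polyring n" "\<And>A. A \<subseteq> {..<w} \<Longrightarrow> c2 A = kos l w b0 A"
    using Suc.IH[OF lR' reg c2R kc2 c20] by blast
  define b where "b = (\<lambda>B. if w \<in> B then - b2 (B - {w}) else b0 B)"
  have "c B = kos l (Suc w) b B" if B: "B \<subseteq> {..<Suc w}" for B
  proof (cases "w \<in> B")
    case True
    define A where "A = B - {w}"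
    have A: "A \<subseteq> {..<w}" "B = insert w A" "w \<notin> A" using B True by (auto simp: A_def less_Suc_eq)
    have "kos l w b B = kos l w (\<lambda>X. b (insert w X)) A" by (simp add: A(2) kos_insert)
    also have "\<dots> = kos l w (\<lambda>X. - b2 X) A"
      using A(3) by (intro kos_cong) (auto simp: b_def insert_Diff_if)
    also have "\<dots> = - c B" using b2[OF A(1)] by (simp add: kos_uminus c1_def A(2))
    finally show ?thesis using True by simp
  next
    case False
    then have A: "B \<subseteq> {..<w}" using B by (auto simp: less_Suc_eq)
    have "kos l w b B = kos l w b0 B" using False by (intro kos_cong) (auto simp: b_def)
    also have "\<dots> = c B + l w * b2 B" using b0(2)[OF A] by (simp add: c2_def)
    finally show ?thesis using False by (simp add: b_def)
  qed
  moreover have "b B \<in> polyring n" for B using b2R b0(1) by (simp add: b_def)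
  ultimately show ?case by blast
qed

text \<open>\<open>e\<close> is the degree of the coefficients. Each index counts as a basis factor
  of degree one, so the total degree, preserved by the differential, is
  \<open>e + i\<close>.\<close>

definition kos_chain :: "nat \<Rightarrow> nat \<Rightarrow> nat \<Rightarrow> int \<Rightarrow> (nat set \<Rightarrow> 'k::field mpoly) \<Rightarrow> bool" where
  "kos_chain n w i e c \<longleftrightarrow> (\<forall>B. c B \<in> hom_int n e) \<and> (\<forall>B. c B \<noteq> 0 \<longrightarrow> B \<subseteq> {..<w} \<and> card B = i)"

text \<open>Projection onto one bidegree, needed because exactness and ideal membership supply only
  inhomogeneous coefficients.\<close>

definition kos_part :: "nat \<Rightarrow> nat \<Rightarrow> int \<Rightarrow> (nat set \<Rightarrow> 'k::field mpoly) \<Rightarrow> nat set \<Rightarrow> 'k mpoly" where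
  "kos_part w i e c B = (if B \<subseteq> {..<w} \<and> card B = i then hpart e (c B) else 0)"

lemma kos_chain_kos_part:
  "(\<And>B. c B \<in> polyring n) \<Longrightarrow> kos_chain n w i e (kos_part w i e c)"
  by (auto simp: kos_chain_def kos_part_def hpart_in_hom_int)

lemma hpart_kos:
  assumes "\<And>i. i < w \<Longrightarrow> l i \<in> hom_int n 1"
  shows "hpart (e + 1) (kos l w c B) = kos l w (\<lambda>B. hpart e (c B)) B"
  using assms
proof (induction w)
  case (Suc w)
  have "hpart (e + 1) (l w * c (insert w B)) = l w * hpart e (c (insert w B))"
    using hpart_mult[of "l w" n 1 "e + 1"] Suc.prems[of w] by simp
  then show ?case using Suc by (simp add: hpart_add hpart_uminus)
qed simp

lemma kos_kos_part:
  assumes "\<And>i. i < w \<Longrightarrow> l i \<in> hom_int n 1" "B \<subseteq> {..<w}" "card B = i"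
  shows "kos l w (kos_part w (Suc i) e c) B = hpart (e + 1) (kos l w c B)"
proof -
  have "finite B" using assms(2) finite_subset by blast
  then have "kos l w (kos_part w (Suc i) e c) B = kos l w (\<lambda>B. hpart e (c B)) B"
    using assms(2,3) by (intro kos_cong) (auto simp: kos_part_def)
  then show ?thesis using hpart_kos[of w l n, OF assms(1)] by simp
qed

lemma kos_chain_kos:
  assumes "\<And>i. i < w \<Longrightarrow> l i \<in> hom_int n 1" "kos_chain n w (Suc i) e c"
  shows "kos_chain n w i (e + 1) (kos l w c)"
  unfolding kos_chain_def
proof (intro conjI allI impI)
  fix B
  show "kos l w c B \<in> hom_int n (e + 1)"
    using assms by (intro kos_hom_int) (auto simp: kos_chain_def)
  assume nz: "kos l w c B \<noteq> 0"
  have "\<exists>j<w. j \<notin> B \<and> c (insert j B) \<noteq> 0"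
  proof (rule ccontr)
    assume "\<not> ?thesis"
    then have "kos l w c B = kos l w (\<lambda>_. 0) B" by (intro kos_cong) auto
    with nz show False by simp
  qed
  then obtain j where j: "j < w" "j \<notin> B" "insert j B \<subseteq> {..<w}" "card (insert j B) = Suc i"
    using assms(2) by (auto simp: kos_chain_def)
  then have "finite B" using finite_subset[of "insert j B" "{..<w}"] by simp
  then show "card B = i" using j by simp
  show "B \<subseteq> {..<w}" using j(3) by simp
qed

lemma kos_chain_diff:
  assumes "kos_chain n w i e c" "kos_chain n w i e c'"
  shows "kos_chain n w i e (\<lambda>B. c B - c' B)"
  unfolding kos_chain_def
proof (intro conjI allI impI)
  fix B
  show "c B - c' B \<in> hom_int n e" using assms by (auto simp: kos_chain_def intro: hom_int_diff)
  assume "c B - c' B \<noteq> 0"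
  then have "c B \<noteq> 0 \<or> c' B \<noteq> 0" by auto
  then show "B \<subseteq> {..<w}" "card B = i" using assms unfolding kos_chain_def by blast+
qed

lemma kos_chain_mult:
  assumes "kos_chain n w i e c" "f \<in> hom_int n d"
  shows "kos_chain n w i (d + e) (\<lambda>B. f * c B)"
  using assms unfolding kos_chain_def by (metis hom_int_mult mult_zero_right)

lemma kos_chain_polyring: "kos_chain n w i e c \<Longrightarrow> c B \<in> polyring n"
  by (auto simp: kos_chain_def hom_int_def)

text \<open>For a regular sequence \<^term>\<open>l\<close> of linear forms and a regular sequence \<^term>\<open>f\<close>, the homology
  \<open>Tor\<^sub>i(S/(l), S/(f))\<close> can be computed from either Koszul complex.  The one on \<^term>\<open>f\<close> shows that it
  lives in degrees at least \<open>d\<^sub>1 + \<dots> + d\<^sub>i\<close>.  On the side of \<^term>\<open>l\<close> this is the following statement,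
  which is obtained by adding the \<^term>\<open>f h\<close> one at a time.\<close>

lemma kos_graded_exact:
  assumes l1: "\<And>i. i < w \<Longrightarrow> l i \<in> hom_int n 1"
    and lreg: "\<And>j r. j < w \<Longrightarrow> r \<in> polyring n \<Longrightarrow> r * l j \<in> ideal_gen n (l ` {..<j})
      \<Longrightarrow> r \<in> ideal_gen n (l ` {..<j})"
    and fh: "\<And>i. i < h \<Longrightarrow> f i \<in> hom_int n (int (d i))"
    and freg: "\<And>i r. i < h \<Longrightarrow> r \<in> polyring n \<Longrightarrow> r * f i \<in> ideal_gen n (f ` {..<i})
      \<Longrightarrow> r \<in> ideal_gen n (f ` {..<i})"
    and sorted: "\<And>i j. i \<le> j \<Longrightarrow> j < h \<Longrightarrow> d i \<le> d j"
    and c: "kos_chain n w i e c"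
    and dc: "\<And>B. kos l w c B \<in> ideal_gen n (f ` {..<h})"
    and deg: "i \<le> h \<Longrightarrow> e + int i < (\<Sum>s<i. int (d s))"
  shows "\<exists>a. kos_chain n w (Suc i) (e - 1) a
    \<and> (\<forall>B. B \<subseteq> {..<w} \<longrightarrow> c B - kos l w a B \<in> ideal_gen n (f ` {..<h}))"
  \<comment> \<open>For \<open>i > h\<close> no degree bound is asked, since a Koszul complex on
    \<open>h\<close> elements stops at \<open>h\<close>. The induction generalizes \<open>i\<close>,
    \<open>e\<close> and \<open>c\<close> because its step also works in homological degree
    \<open>i - 1\<close>.\<close>
  using fh freg sorted c dc deg
proof (induction h arbitrary: i e c)
  \<comment> \<open>In homological degree zero the bound reads \<open>e < 0\<close>, so the chain
    itself vanishes.\<close>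
  have triv: "\<exists>a. kos_chain n w (Suc 0) (e - 1) a \<and> (\<forall>B. B \<subseteq> {..<w} \<longrightarrow> c B - kos l w a B \<in> I)"
    if "kos_chain n w 0 e c" "e < 0" "is_ideal n I" for c :: "nat set \<Rightarrow> 'a mpoly" and e I
  proof -
    have "c B = 0" for B using that hom_int_neg unfolding kos_chain_def by blast
    then show ?thesis using ideal_0[OF that(3)]
      by (intro exI[of _ "\<lambda>_. 0"]) (auto simp: kos_chain_def)
  qed
  {
    case (0 i e c)
    show ?case
    proof (cases i)
      case 0
      have "is_ideal n {0}" using is_ideal_gen[of "{}" n] by simp
      with triv[of e c "{0}"] 0 "0.prems" show ?thesis by simp
    next
      case (Suc i')
      have c0: "c B = 0" if "card B \<noteq> i" for B
        using "0.prems"(4) that unfolding kos_chain_def by blast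
      have lR: "l j \<in> polyring n" if "j < w" for j using l1[OF that] hom_int_polyring by blast
      have "\<exists>b. (\<forall>B. b B \<in> polyring n) \<and> (\<forall>B. B \<subseteq> {..<w} \<longrightarrow> c B = kos l w b B)"
      proof (rule kos_exact[OF lR lreg kos_chain_polyring[OF "0.prems"(4)]])
        show "kos l w c B = 0" for B using "0.prems"(5)[of B] by simp
        have "c {} = 0" using c0 Suc by simp
        moreover have "l ` {..<w} \<subseteq> polyring n" using lR by blast
        ultimately show "c {} \<in> ideal_gen n (l ` {..<w})" by (simp add: ideal_0[OF is_ideal_gen])
      qed auto
      then obtain b where b: "\<And>B. b B \<in> polyring n" "\<And>B. B \<subseteq> {..<w} \<Longrightarrow> c B = kos l w b B" by blast
      define a where "a = kos_part w (Suc i) (e - 1) b"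
      have a: "kos_chain n w (Suc i) (e - 1) a"
        unfolding a_def by (rule kos_chain_kos_part) (rule b)
      have ka: "kos_chain n w i (e - 1 + 1) (kos l w a)" by (rule kos_chain_kos[OF l1 a])
      have "c B = kos l w a B" if B: "B \<subseteq> {..<w}" for B
      proof (cases "card B = i")
        case True
        have "kos l w a B = hpart (e - 1 + 1) (kos l w b B)"
          unfolding a_def by (rule kos_kos_part[OF l1 B True])
        also have "\<dots> = hpart e (c B)" using b(2)[OF B] by simp
        also have "\<dots> = c B"
          using "0.prems"(4) unfolding kos_chain_def by (intro hpart_id) blast
        finally show ?thesis by simp
      next
        case False
        then have "kos l w a B = 0" using ka unfolding kos_chain_def by blast
        then show ?thesis using c0[OF False] by simp
      qed
      then show ?thesis using a by (intro exI[of _ a]) auto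
    qed
  next
    case (Suc h i e c)
    let ?I = "ideal_gen n (f ` {..<h})" and ?J = "ideal_gen n (f ` {..<Suc h})"
    have fR: "f j \<in> polyring n" if "j < Suc h" for j
      using Suc.prems(1)[OF that] hom_int_polyring by blast
    have fhR: "f h \<in> polyring n" "f ` {..<h} \<subseteq> polyring n" "f ` {..<Suc h} \<subseteq> polyring n"
      using fR by auto
    note I = is_ideal_gen[OF fhR(2)] and J = is_ideal_gen[OF fhR(3)]
    have mem: "p \<in> ?J \<longleftrightarrow> (\<exists>u\<in>?I. \<exists>v\<in>polyring n. p = u + f h * v)" for p
      using ideal_gen_insert[OF fhR(2,1)] by (simp add: lessThan_Suc)
    have f1: "f j \<in> hom_int n (int (d j))" if "j < h" for j using Suc.prems(1) that by simp
    have f2: "r \<in> ideal_gen n (f ` {..<j})"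
      if "j < h" "r \<in> polyring n" "r * f j \<in> ideal_gen n (f ` {..<j})" for j r
      using Suc.prems(2)[of j r] that by simp
    have f3: "d j \<le> d k" if "j \<le> k" "k < h" for j k using Suc.prems(3) that by simp
    have IH: "\<exists>a. kos_chain n w (Suc i) (e - 1) a \<and> (\<forall>B. B \<subseteq> {..<w} \<longrightarrow> c B - kos l w a B \<in> ?I)"
      if "kos_chain n w i e c" "\<And>B. kos l w c B \<in> ?I" "i \<le> h \<Longrightarrow> e + int i < (\<Sum>s<i. int (d s))"
      for i e c
      by (rule Suc.IH[OF f1 f2 f3 that])
    show ?case
    proof (cases i)
      case 0
      then show ?thesis using triv[OF _ _ J, of e c] Suc.prems(4,6) by simp
    next
      case i: (Suc i')
      \<comment> \<open>The long exact sequence of multiplication by \<open>f h\<close>: if the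
        differential of \<open>c\<close> is \<open>u + f h * v\<close>, the connecting map sends the
        class of \<open>c\<close> to that of \<open>v\<close>, whose coefficients have degree
        \<open>?e\<close>.\<close>
      let ?D = "int (d h)" and ?e = "e + 1 - int (d h)"
      have kc: "kos_chain n w i' (e + 1) (kos l w c)"
        by (rule kos_chain_kos[OF l1 Suc.prems(4)[unfolded i]])
      have "\<exists>v. v \<in> polyring n \<and> kos l w c B - f h * v \<in> ?I" for B
      proof -
        obtain u v where "u \<in> ?I" "v \<in> polyring n" "kos l w c B = u + f h * v"
          using Suc.prems(5)[of B] mem by blast
        then show ?thesis by (intro exI[of _ v]) simp
      qed
      then obtain v0 where v0: "\<And>B. v0 B \<in> polyring n" "\<And>B. kos l w c B - f h * v0 B \<in> ?I" by metis
      define v where "v = kos_part w i' ?e v0"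
      have v: "kos_chain n w i' ?e v" unfolding v_def by (rule kos_chain_kos_part) (rule v0)
      define u where "u = (\<lambda>B. kos l w c B - f h * v B)"
      have fhom: "f h \<in> hom_int n ?D" using Suc.prems(1) by simp
      have u: "u B \<in> ?I" for B
      proof (cases "B \<subseteq> {..<w} \<and> card B = i'")
        case True
        have "hpart (e + 1) (kos l w c B - f h * v0 B) \<in> ?I"
          by (rule hpart_ideal_gen[OF fhR(2) _ v0(2)]) (use Suc.prems(1) less_SucI in blast)
        moreover have "hpart (e + 1) (kos l w c B) = kos l w c B"
          by (rule hpart_id[of _ n]) (use kc in \<open>simp add: kos_chain_def\<close>)
        ultimately show ?thesis
          using True by (simp add: u_def v_def kos_part_def hpart_diff hpart_mult[OF fhom])
      next
        case False
        then have "kos l w c B = 0" "v B = 0" using kc v unfolding kos_chain_def by blast+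
        then show ?thesis by (simp add: u_def ideal_0[OF I])
      qed
      \<comment> \<open>Applying the differential to \<open>u + f h * v\<close> gives 0, so
        \<open>f h\<close> times the differential of \<open>v\<close> lies in \<open>?I\<close>, and
        regularity removes \<open>f h\<close>.\<close>
      have dv: "kos l w v B \<in> ?I" for B
      proof -
        have "kos l w (kos l w c) B = kos l w (\<lambda>B. u B + f h * v B) B" by (simp add: u_def)
        then have "f h * kos l w v B = - kos l w u B"
          by (simp only: kos_kos kos_add kos_mult) (simp add: eq_neg_iff_add_eq_0 add.commute)
        moreover have "kos l w u B \<in> ?I"
          using u l1 by (intro kos_in_ideal[OF I] ideal_mult[OF I]) (auto intro: hom_int_polyring)
        ultimately have "kos l w v B * f h \<in> ?I"
          using ideal_uminus[OF I] by (simp add: mult.commute)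
        moreover have "kos l w v B \<in> polyring n"
          using l1 by (intro kos_polyring kos_chain_polyring[OF v]) (auto intro: hom_int_polyring)
        ultimately show ?thesis using Suc.prems(2)[of h] by simp
      qed
      \<comment> \<open>The total degree drops by \<open>d h\<close>, which is at least the last
        summand \<open>d i'\<close> of the bound because \<open>d\<close> is sorted.\<close>
      have "?e + int i' < (\<Sum>s<i'. int (d s))" if "i' \<le> h"
        using Suc.prems(6) Suc.prems(3)[of i' h] that by (simp add: i)
      from IH[OF v dv this] obtain a where a: "kos_chain n w (Suc i') (?e - 1) a"
          "\<And>B. B \<subseteq> {..<w} \<Longrightarrow> v B - kos l w a B \<in> ?I" by blast
      have kka: "kos_chain n w i' (?e - 1 + 1) (kos l w a)" by (rule kos_chain_kos[OF l1 a(1)])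
      have ka: "v B - kos l w a B \<in> ?I" for B
      proof (cases "B \<subseteq> {..<w}")
        case False
        then have "v B = 0" "kos l w a B = 0"
          using v kka unfolding kos_chain_def by blast+
        then show ?thesis by (simp add: ideal_0[OF I])
      qed (rule a(2))
      \<comment> \<open>Subtracting \<open>f h * a\<close> changes nothing modulo \<open>?J\<close>
        but brings the differential into the smaller ideal \<open>?I\<close>.\<close>
      define c2 where "c2 = (\<lambda>B. c B - f h * a B)"
      have "kos_chain n w i (?D + (?e - 1)) (\<lambda>B. f h * a B)"
        using kos_chain_mult[OF a(1) fhom] by (simp add: i)
      then have c2: "kos_chain n w i e c2"
        unfolding c2_def by (intro kos_chain_diff Suc.prems(4)) simp
      have dc2: "kos l w c2 B \<in> ?I" for B
      proof -
        have "kos l w c2 B = u B + f h * (v B - kos l w a B)"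
          unfolding c2_def u_def kos_diff kos_mult by (simp add: algebra_simps)
        then show ?thesis using u ka fhR(1) by (auto intro: ideal_add[OF I] ideal_mult[OF I])
      qed
      have "e + int i < (\<Sum>s<i. int (d s))" if "i \<le> h" using Suc.prems(6) that by simp
      from IH[OF c2 dc2 this] obtain b where b: "kos_chain n w (Suc i) (e - 1) b"
          "\<And>B. B \<subseteq> {..<w} \<Longrightarrow> c2 B - kos l w b B \<in> ?I" by blast
      have "c B - kos l w b B \<in> ?J" if "B \<subseteq> {..<w}" for B
        using b(2)[OF that] kos_chain_polyring[OF a(1), of B] unfolding mem
        by (intro bexI[of _ "c2 B - kos l w b B"] bexI[of _ "a B"]) (auto simp: c2_def)
      then show ?thesis using b(1) by blast
    qed
  }
qed

section \<open>Substitution and linear forms\<close>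

abbreviation var :: "nat \<Rightarrow> 'k::field mpoly" where
  "var i \<equiv> monom (Poly_Mapping.single i (Suc 0))"

definition subst_mono :: "(nat \<Rightarrow> 'k::field mpoly) \<Rightarrow> (nat \<Rightarrow>\<^sub>0 nat) \<Rightarrow> 'k mpoly" where
  "subst_mono g \<alpha> = (\<Prod>i\<in>keys \<alpha>. g i ^ lk \<alpha> i)"

definition subst :: "(nat \<Rightarrow> 'k::field mpoly) \<Rightarrow> 'k mpoly \<Rightarrow> 'k mpoly" where
  "subst g p = (\<Sum>\<alpha>\<in>keys p. Poly_Mapping.single 0 (lk p \<alpha>) * subst_mono g \<alpha>)"

lemma poly_mapping_sum_singles:
  "(\<Sum>i\<in>keys p. Poly_Mapping.single i (lk p i)) = (p :: 'a \<Rightarrow>\<^sub>0 'b::comm_monoid_add)"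
  by (rule poly_mapping_eqI)
    (auto simp: lookup_sum lookup_single when_def in_keys_iff)

lemma subst_mono_superset:
  assumes "finite A" "keys \<alpha> \<subseteq> A"
  shows "subst_mono g \<alpha> = (\<Prod>i\<in>A. g i ^ lk \<alpha> i)"
  unfolding subst_mono_def using assms
  by (intro prod.mono_neutral_left) (auto simp: in_keys_iff)

lemma subst_mono_add: "subst_mono g (\<alpha> + \<beta>) = subst_mono g \<alpha> * subst_mono g \<beta>"
proof -
  let ?A = "keys \<alpha> \<union> keys \<beta>"
  show ?thesis
    using subst_mono_superset[of ?A "\<alpha> + \<beta>" g] subst_mono_superset[of ?A \<alpha> g]
      subst_mono_superset[of ?A \<beta> g] keys_add[of \<alpha> \<beta>]
    by (simp add: lookup_add power_add prod.distrib)
qed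

lemma var_power: "var i ^ e = (monom (Poly_Mapping.single i e) :: 'k::field mpoly)"
proof (induction e)
  case 0
  show ?case by (simp add: monom_def)
next
  case (Suc e)
  then show ?case by (simp add: monom_mult flip: single_add)
qed

lemma monom_eq_prod: "monom \<alpha> = (\<Prod>i\<in>keys \<alpha>. var i ^ lk \<alpha> i :: 'k::field mpoly)"
proof -
  have "(\<Prod>i\<in>A. monom (h i)) = (monom (\<Sum>i\<in>A. h i) :: 'k mpoly)" if "finite A" for A :: "nat set" and h
    using that by (induction A) (auto simp: monom_mult, simp add: monom_def)
  from this[of "keys \<alpha>" "\<lambda>i. Poly_Mapping.single i (lk \<alpha> i)"] show ?thesis
    by (simp add: var_power poly_mapping_sum_singles)
qed

lemma subst_superset:
  assumes "finite A" "keys p \<subseteq> A"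
  shows "subst g p = (\<Sum>\<alpha>\<in>A. Poly_Mapping.single 0 (lk p \<alpha>) * subst_mono g \<alpha>)"
  unfolding subst_def using assms
  by (intro sum.mono_neutral_left) (auto simp: in_keys_iff)

lemma subst_add: "subst g (p + q) = subst g p + subst g q"
proof -
  let ?A = "keys p \<union> keys q"
  show ?thesis
    using subst_superset[of ?A "p + q" g] subst_superset[of ?A p g]
      subst_superset[of ?A q g] keys_add[of p q]
    by (simp add: lookup_add single_add distrib_right sum.distrib)
qed

lemma subst_0 [simp]: "subst g 0 = 0"
  by (simp add: subst_def)

lemma subst_sum: "subst g (sum h A) = (\<Sum>x\<in>A. subst g (h x))"
  by (induction A rule: infinite_finite_induct) (auto simp: subst_add)

lemma subst_diff: "subst g (p - q) = subst g p - subst g q"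
  using subst_add[of g "p - q" q] by simp

lemma subst_single: "subst g (Poly_Mapping.single \<alpha> c) = Poly_Mapping.single 0 c * subst_mono g \<alpha>"
  by (cases "c = 0") (auto simp: subst_def)

lemma subst_mult: "subst g (p * q) = subst g p * subst g q"
proof -
  have "p * q = (\<Sum>\<alpha>\<in>keys p. \<Sum>\<beta>\<in>keys q. Poly_Mapping.single (\<alpha> + \<beta>) (lk p \<alpha> * lk q \<beta>))"
    by (subst (1 2) poly_mapping_sum_singles[symmetric]) (simp add: sum_product mult_single)
  also have "subst g \<dots> = (\<Sum>\<alpha>\<in>keys p. \<Sum>\<beta>\<in>keys q. (Poly_Mapping.single 0 (lk p \<alpha>) * subst_mono g \<alpha>)
      * (Poly_Mapping.single 0 (lk q \<beta>) * subst_mono g \<beta>))"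
    unfolding subst_sum subst_single subst_mono_add
    by (intro sum.cong refl) (metis (no_types, lifting) add_0 mult.assoc mult.left_commute mult_single)
  also have "\<dots> = subst g p * subst g q"
    by (simp add: subst_def sum_product)
  finally show ?thesis .
qed

lemma subst_var: "subst g (var i) = g i"
  unfolding monom_def subst_single by (simp add: subst_mono_def flip: single_one)

lemma subst_fixes:
  assumes "\<And>\<alpha> i. \<alpha> \<in> keys p \<Longrightarrow> i \<in> keys \<alpha> \<Longrightarrow> g i = var i"
  shows "subst g p = p"
proof -
  have "subst_mono g \<alpha> = monom \<alpha>" if "\<alpha> \<in> keys p" for \<alpha>
    unfolding monom_eq_prod[of \<alpha>] subst_mono_def using assms[OF that] by (intro prod.cong) auto
  then have "subst g p = (\<Sum>\<alpha>\<in>keys p. Poly_Mapping.single \<alpha> (lk p \<alpha>))"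
    by (simp add: subst_def monom_def mult_single)
  then show ?thesis by (simp add: poly_mapping_sum_singles)
qed

text \<open>Each variable equals its substitute modulo \<open>J\<close>, and products and sums
  respect this. Hence a polynomial killed by the substitution lies in \<open>J\<close>.\<close>

lemma subst_congruent:
  assumes J: "is_ideal n J" and g: "\<And>i. i < n \<Longrightarrow> g i \<in> polyring n"
    and var_g: "\<And>i. i < n \<Longrightarrow> var i - g i \<in> J" and p: "p \<in> polyring n"
  shows "p - subst g p \<in> J"
proof -
  have mult: "a * c - b * d \<in> J"
    if "a - b \<in> J" "c - d \<in> J" "a \<in> polyring n" "d \<in> polyring n" for a b c d :: "'a mpoly"
  proof -
    have "a * c - b * d = a * (c - d) + (a - b) * d" by (simp add: algebra_simps)
    then show ?thesis
      using ideal_add[OF J ideal_mult[OF J that(3,2)] ideal_mult2[OF J that(4,1)]] by simp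
  qed
  have pow: "var i ^ e - g i ^ e \<in> J" if i: "i < n" for i e
  proof (induction e)
    case (Suc e)
    show ?case unfolding power_Suc
      by (rule mult[OF var_g[OF i] Suc]) (auto intro!: polyring_monom polyring_power g i simp: i)
  qed (simp add: ideal_0[OF J])
  have "(\<Prod>i\<in>A. var i ^ lk \<alpha> i) - (\<Prod>i\<in>A. g i ^ lk \<alpha> i) \<in> J" if "A \<subseteq> {..<n}" for A \<alpha>
    using that
  proof (induction A rule: infinite_finite_induct)
    case (insert i A)
    have "(\<Prod>i\<in>A. g i ^ lk \<alpha> i) \<in> polyring n"
      using insert.prems by (auto intro!: polyring_prod polyring_power g)
    moreover have "var i ^ lk \<alpha> i \<in> polyring n"
      using insert.prems by (auto intro!: polyring_power polyring_monom)
    ultimately show ?case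
      using insert mult[OF pow[of i "lk \<alpha> i"], of "\<Prod>i\<in>A. var i ^ lk \<alpha> i" "\<Prod>i\<in>A. g i ^ lk \<alpha> i"] by simp
  qed (auto simp: ideal_0[OF J])
  then have mono: "monom \<alpha> - subst_mono g \<alpha> \<in> J" if "mvars_in n \<alpha>" for \<alpha>
    using that unfolding monom_eq_prod[of \<alpha>] subst_mono_def by (simp add: mvars_in_keys)
  have "p - subst g p = (\<Sum>\<alpha>\<in>keys p. Poly_Mapping.single \<alpha> (lk p \<alpha>))
      - (\<Sum>\<alpha>\<in>keys p. Poly_Mapping.single 0 (lk p \<alpha>) * subst_mono g \<alpha>)"
    by (simp add: subst_def poly_mapping_sum_singles)
  also have "\<dots> = (\<Sum>\<alpha>\<in>keys p. Poly_Mapping.single 0 (lk p \<alpha>) * (monom \<alpha> - subst_mono g \<alpha>))"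
    unfolding right_diff_distrib sum_subtractf by (simp add: monom_def mult_single)
  also have "\<dots> \<in> J"
    using p by (intro ideal_sum[OF J] ideal_mult[OF J] mono polyring_single) (auto simp: polyring_def)
  finally show ?thesis .
qed

text \<open>The forms are in echelon form: \<open>l s\<close> has pivot \<open>t s\<close>, and no
  \<open>y s\<close> involves a pivot. Substituting \<open>y s\<close> for the first
  \<open>j\<close> pivots kills the first \<open>j\<close> forms, fixes \<open>l j\<close>, and
  changes a polynomial only modulo those forms. Since polynomials form a domain and
  \<open>l j\<close> is nonzero, \<open>r\<close> must be killed too.\<close>

lemma linear_forms_regular:
  fixes y l :: "nat \<Rightarrow> 'k::field mpoly"
  assumes t: "\<And>s. s < w \<Longrightarrow> t s < n" "inj_on t {..<w}"
    and y: "\<And>s. s < w \<Longrightarrow> y s \<in> polyring n"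
    and y_free: "\<And>s \<alpha> i. s < w \<Longrightarrow> \<alpha> \<in> keys (y s) \<Longrightarrow> i \<in> keys \<alpha> \<Longrightarrow> i \<notin> t ` {..<w}"
    and l: "\<And>s. s < w \<Longrightarrow> l s = var (t s) - y s"
    and j: "j < w" and r: "r \<in> polyring n" and rl: "r * l j \<in> ideal_gen n (l ` {..<j})"
  shows "r \<in> ideal_gen n (l ` {..<j})"
proof -
  define g :: "nat \<Rightarrow> 'k mpoly" where
    "g i = (if i \<in> t ` {..<j} then y (inv_into {..<j} t i) else var i)" for i
  have inj: "inj_on t {..<j}" using t(2) j by (auto simp: inj_on_def)
  have g_t: "g (t s) = y s" if "s < j" for s
    using that inj by (simp add: g_def inv_into_f_f)
  have g_y: "subst g (y s) = y s" if "s < w" for s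
  proof (rule subst_fixes)
    fix \<alpha> i assume "\<alpha> \<in> keys (y s)" "i \<in> keys \<alpha>"
    then have "i \<notin> t ` {..<w}" by (rule y_free[OF that])
    then show "g i = var i" using j by (auto simp: g_def)
  qed
  have lR: "l s \<in> polyring n" if "s < w" for s
    using l y t(1) that by (auto intro!: polyring_diff polyring_monom)
  have "l ` {..<j} \<subseteq> polyring n" using lR j by auto
  note J = is_ideal_gen[OF this]
  have "is_ideal n {p \<in> polyring n. subst g p = 0}"
    by (rule is_idealI) (auto simp: subst_add subst_mult)
  moreover have "l ` {..<j} \<subseteq> {p \<in> polyring n. subst g p = 0}"
    using j lR by (auto simp: l subst_diff subst_var g_t g_y)
  ultimately have "subst g (r * l j) = 0"
    using ideal_gen_least rl by blast
  moreover have "subst g (l j) = l j"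
  proof -
    have "t j \<notin> t ` {..<j}"
      using inj_on_image_mem_iff[OF t(2), of j "{..<j}"] j by auto
    then have "g (t j) = var (t j)" by (simp add: g_def)
    then show ?thesis unfolding l[OF j] subst_diff subst_var g_y[OF j] by simp
  qed
  moreover have "l j \<noteq> 0"
  proof -
    have "Poly_Mapping.single (t j) (Suc 0) \<notin> keys (y j)" using y_free[OF j, of "Poly_Mapping.single (t j) (Suc 0)" "t j"] j by auto
    then have "lk (l j) (Poly_Mapping.single (t j) (Suc 0)) = 1"
      by (simp add: l[OF j] lookup_minus monom_def in_keys_iff)
    then show ?thesis by auto
  qed
  ultimately have "subst g r = 0" by (simp add: subst_mult)
  moreover have "r - subst g r \<in> ideal_gen n (l ` {..<j})"
  proof (rule subst_congruent[OF J _ _ r])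
    fix i assume i: "i < n"
    show "g i \<in> polyring n"
    proof (cases "i \<in> t ` {..<j}")
      case True
      then obtain s where "s < j" "i = t s" by auto
      then show ?thesis using g_t y j by simp
    qed (auto simp: g_def i intro: polyring_monom)
    show "var i - g i \<in> ideal_gen n (l ` {..<j})"
    proof (cases "i \<in> t ` {..<j}")
      case True
      then obtain s where "s < j" "i = t s" by auto
      then have "var i - g i = l s" using g_t l[of s] j by simp
      then show ?thesis using \<open>s < j\<close> by (auto intro!: ideal_gen_base)
    qed (auto simp: g_def ideal_0[OF J])
  qed
  ultimately show ?thesis by simp
qed

text \<open>The variables outside \<open>A\<close> are the pivots of \<open>n - card A\<close>
  linear forms annihilating \<open>G\<close> modulo \<open>(f)\<close>. Were the inequality false,
  graded exactness would make \<open>G\<close> times the top basis element a boundary modulo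
  \<open>(f)\<close>, hence zero there.\<close>

lemma annihilator_degree:
  fixes f :: "nat \<Rightarrow> 'k::field mpoly"
  assumes fh: "\<And>i. i < n \<Longrightarrow> f i \<in> hom_comp n (d i)"
    and freg: "regular_sequence n n f"
    and sorted: "\<And>i j. i \<le> j \<Longrightarrow> j < n \<Longrightarrow> d i \<le> d j"
    and G: "G \<in> hom_comp n e" "G \<notin> ideal_gen n (f ` {..<n})"
    and A: "A \<subseteq> {..<n}"
    and ann: "\<And>i. i < n \<Longrightarrow> i \<notin> A \<Longrightarrow>
      (var i - (\<Sum>a\<in>A. Poly_Mapping.single 0 (c i a) * var a)) * G \<in> ideal_gen n (f ` {..<n})"
  shows "(\<Sum>s<n - card A. d s) \<le> e + (n - card A)"
proof (rule ccontr)
  assume neg: "\<not> ?thesis"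
  define w where "w = n - card A"
  define y where "y i = (\<Sum>a\<in>A. Poly_Mapping.single 0 (c i a) * var a :: 'k mpoly)" for i
  have fin: "finite A" using A finite_subset by blast
  have "card ({..<n} - A) = w" using A fin by (simp add: w_def card_Diff_subset)
  then obtain t where t: "bij_betw t {..<w} ({..<n} - A)"
    using ex_bij_betw_nat_finite[of "{..<n} - A"] by (auto simp: atLeast0LessThan)
  have tn: "t s < n" "t s \<notin> A" if "s < w" for s
    using t that by (auto simp: bij_betw_def)
  define l where "l s = var (t s) - y (t s)" for s
  have y_keys: "\<exists>a\<in>A. \<alpha> = Poly_Mapping.single a (Suc 0)" if "\<alpha> \<in> keys (y i)" for i \<alpha>
  proof -
    have "lk (y i) \<alpha> = (\<Sum>a\<in>A. c i a when Poly_Mapping.single a (Suc 0) = \<alpha>)"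
      by (simp add: y_def lookup_sum monom_def mult_single lookup_single)
    moreover have "\<dots> = 0" if "\<not> (\<exists>a\<in>A. \<alpha> = Poly_Mapping.single a (Suc 0))"
      using that by (intro sum.neutral) (auto simp: when_def)
    ultimately show ?thesis using that by (auto simp: in_keys_iff)
  qed
  have yh: "y i \<in> hom_int n 1" for i
    using y_keys[of _ i] A by (fastforce simp: hom_int_def polyring_def)
  have vh: "var i \<in> hom_int n 1" if "i < n" for i
    using hom_comp_monom[of n "Poly_Mapping.single i (Suc 0)"] that
    by (simp add: hom_comp_def hom_int_def)
  have lh: "l s \<in> hom_int n 1" if "s < w" for s
    unfolding l_def by (rule hom_int_diff[OF vh yh]) (use tn that in auto)
  let ?I = "ideal_gen n (f ` {..<n})"
  have "f ` {..<n} \<subseteq> polyring n" using freg by (auto simp: regular_sequence_def)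
  note I = is_ideal_gen[OF this]
  define g where "g B = (if B = {..<w} then G else 0)" for B
  have "\<exists>a. kos_chain n w (Suc w) (int e - 1) a
    \<and> (\<forall>B. B \<subseteq> {..<w} \<longrightarrow> g B - kos l w a B \<in> ?I)"
  proof (rule kos_graded_exact[OF lh])
    show "r \<in> ideal_gen n (l ` {..<j})"
      if "j < w" "r \<in> polyring n" "r * l j \<in> ideal_gen n (l ` {..<j})" for j r
    proof (rule linear_forms_regular[of w t n "\<lambda>s. y (t s)" l])
      show "inj_on t {..<w}" using t by (simp add: bij_betw_def)
      show "i \<notin> t ` {..<w}" if "\<alpha> \<in> keys (y (t s))" "i \<in> keys \<alpha>" for s \<alpha> i
        using y_keys[OF that(1)] that(2) tn by auto
      show "y (t s) \<in> polyring n" for s using yh hom_int_polyring by blast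
    qed (use that tn in \<open>auto simp: l_def\<close>)
    show "f i \<in> hom_int n (int (d i))" if "i < n" for i
      using fh[OF that] by (simp add: hom_int_of_nat)
    show "r \<in> ideal_gen n (f ` {..<i})"
      if "i < n" "r \<in> polyring n" "r * f i \<in> ideal_gen n (f ` {..<i})" for i r
      using freg that by (auto simp: regular_sequence_def)
    show "kos_chain n w w (int e) g"
      using G(1) by (auto simp: kos_chain_def g_def simp flip: hom_int_of_nat)
    show "kos l w g B \<in> ?I" for B
    proof (rule kos_in_ideal[OF I])
      show "l i * g (insert i B) \<in> ?I" if "i < w" for i
        using ann[of "t i"] tn[OF that] by (auto simp: g_def l_def y_def ideal_0[OF I])
    qed
    show "int e + int w < (\<Sum>s<w. int (d s))"
      using neg by (simp add: w_def flip: of_nat_sum)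
  qed (assumption | rule sorted)+
  then obtain a where a: "kos_chain n w (Suc w) (int e - 1) a"
    "\<And>B. B \<subseteq> {..<w} \<Longrightarrow> g B - kos l w a B \<in> ?I" by blast
  \<comment> \<open>There are only \<open>w\<close> indices, hence no nonzero chain in homological
    degree \<open>w + 1\<close>.\<close>
  have "a B = 0" for B
    using a(1) card_mono[of "{..<w}" B] unfolding kos_chain_def by force
  then have "kos l w a B = 0" for B using kos_cong[of w B a "\<lambda>_. 0" l] by simp
  then have "G \<in> ?I" using a(2)[of "{..<w}"] by (simp add: g_def)
  with G(2) show False ..
qed

section \<open>Dimensions\<close>

text \<open>The polynomial ring can be infinite-dimensional, and \<open>dim\<close>, being a
  cardinality, is 0 on an infinite basis; the finite spanning set \<open>F\<close> restores
  monotonicity.\<close>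

lemma (in vector_space) dim_mono_finite:
  assumes "V \<subseteq> span W" "W \<subseteq> span F" "finite F"
  shows "dim V \<le> dim W"
proof -
  obtain B where B: "B \<subseteq> W" "independent B" "W \<subseteq> span B" "card B = dim W"
    by (rule basis_exists)
  have "finite B" using independent_span_bound[OF assms(3) B(2)] B(1) assms(2) by blast
  moreover have "V \<subseteq> span B" using assms(1) B(3) span_minimal[OF _ subspace_span] by blast
  ultimately show ?thesis using dim_le_card[of V B] B(4) by simp
qed

lemma (in vector_space) dim_insert_finite:
  assumes "V \<subseteq> span F" "finite F" "v \<notin> span V"
  shows "dim (insert v V) = Suc (dim V)"
proof -
  obtain B where B: "B \<subseteq> V" "independent B" "V \<subseteq> span B" "card B = dim V"
    by (rule basis_exists)
  have fin: "finite B" using independent_span_bound[OF assms(2) B(2)] B(1) assms(1) by blast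
  have v: "v \<notin> span B" using assms(3) span_mono[OF B(1)] by blast
  show ?thesis
  proof (rule dim_unique[of "insert v B"])
    show "insert v V \<subseteq> span (insert v B)"
      using B(3) span_mono[of B "insert v B"] span_base[of v "insert v B"] by blast
    show "card (insert v B) = Suc (dim V)"
      using fin v B(4) span_base[of v B] by (subst card_insert_disjoint) auto
    show "independent (insert v B)" using v B(2) by (rule independent_insertI)
  qed (use B in auto)
qed

text \<open>Rank and nullity of the map induced by \<open>T\<close> from \<open>V'\<close> to the
  quotient by \<open>U\<close>, whose kernel is \<open>U'\<close>, written without quotient spaces:
  a basis of \<open>U'\<close> is extended to \<open>V'\<close>, and the images of the new vectors
  are independent over \<open>U\<close>.\<close>

lemma (in vector_space) dim_sum_image:
  assumes T: "Vector_Spaces.linear scale scale T"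
    and U: "subspace U" "U \<subseteq> span F" "finite F"
    and V': "subspace V'" "V' \<subseteq> span F'" "finite F'"
    and U': "subspace U'" "U' \<subseteq> V'"
    and ker: "\<And>x. x \<in> V' \<Longrightarrow> T x \<in> U \<longleftrightarrow> x \<in> U'"
  shows "dim {u + T v |u v. u \<in> U \<and> v \<in> V'} + dim U' = dim U + dim V'"
proof -
  interpret T: Vector_Spaces.linear scale scale T by (rule T)
  obtain B where B: "B \<subseteq> U" "independent B" "U \<subseteq> span B" "card B = dim U"
    by (rule basis_exists)
  have finB: "finite B" using independent_span_bound[OF U(3) B(2)] B(1) U(2) by blast
  have spanB: "span B = U" using B U(1) by (simp add: span_subspace)
  obtain B' where B': "B' \<subseteq> U'" "independent B'" "U' \<subseteq> span B'" "card B' = dim U'"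
    by (rule basis_exists)
  have spanB': "span B' = U'" using B' U'(1) by (simp add: span_subspace)
  obtain C where C: "B' \<subseteq> C" "C \<subseteq> V'" "independent C" "V' \<subseteq> span C"
    using maximal_independent_subset_extend[of B' V'] B' U'(2) by blast
  have finC: "finite C" using independent_span_bound[OF V'(3) C(3)] C(2) V'(2) by blast
  have spanC: "span C = V'" using C V'(1) by (simp add: span_subspace)
  have dimV': "dim V' = card C" using C by (simp add: basis_card_eq_dim)
  have ind: "independent (B \<union> T ` E) \<and> card (B \<union> T ` E) = card B + card E"
    if "finite E" "E \<subseteq> C - B'" for E
    using that
  proof (induction E)
    case empty
    then show ?case using B by simp
  next
    case (insert e E)
    have Te: "T e \<notin> span (B \<union> T ` E)"
    proof
      assume "T e \<in> span (B \<union> T ` E)"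
      then obtain u v where uv: "T e = u + T v" "u \<in> U" "v \<in> span E"
        unfolding span_Un T.span_image spanB by blast
      have e: "e \<in> V'" using insert.prems C(2) by blast
      have "span E \<subseteq> V'" using span_mono[of E C] insert.prems spanC by blast
      then have "e - v \<in> V'" using subspace_diff[OF V'(1) e] uv(3) by blast
      moreover have "T (e - v) = u" using uv(1) by (simp add: T.diff)
      ultimately have "e - v \<in> span B'" using ker[of "e - v"] uv(2) spanB' by simp
      moreover have "B' \<subseteq> C - {e}" "E \<subseteq> C - {e}" using C(1) insert.prems insert.hyps by auto
      ultimately have "e - v \<in> span (C - {e})" "v \<in> span (C - {e})"
        using uv(3) span_mono by blast+
      then have "e - v + v \<in> span (C - {e})" by (rule span_add)
      then have "e \<in> span (C - {e})" by simp
      then show False using C(3) insert.prems unfolding dependent_def by blast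
    qed
    then have "T e \<notin> B \<union> T ` E" using span_base[of "T e" "B \<union> T ` E"] by auto
    moreover have "independent (B \<union> T ` E)" "card (B \<union> T ` E) = card B + card E"
      using insert by auto
    ultimately show ?case
      using Te insert.hyps finB by (simp add: independent_insertI)
  qed
  let ?E = "C - B'" and ?S = "{u + T v |u v. u \<in> U \<and> v \<in> V'}"
  have "?S \<subseteq> span (B \<union> T ` ?E)"
  proof clarify
    fix u v assume uv: "u \<in> U" "v \<in> V'"
    have "B' \<union> ?E = C" using C(1) by blast
    then have "v \<in> span (B' \<union> ?E)" using uv(2) spanC by simp
    then obtain x y where xy: "v = x + y" "x \<in> U'" "y \<in> span ?E"
      unfolding span_Un spanB' by blast
    have "u + T x \<in> U" using xy(2) ker[of x] U'(2) uv(1) U(1) by (blast intro: subspace_add)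
    then have "(u + T x) + T y \<in> span (B \<union> T ` ?E)"
      unfolding span_Un T.span_image spanB using xy(3) by blast
    then show "u + T v \<in> span (B \<union> T ` ?E)" by (simp add: xy(1) T.add add.assoc)
  qed
  moreover have "B \<union> T ` ?E \<subseteq> ?S"
  proof -
    have "b \<in> ?S" if "b \<in> B" for b
      using that B(1) subspace_0[OF V'(1)] by (intro CollectI exI[of _ b] exI[of _ 0]) (auto simp: T.zero)
    moreover have "T x \<in> ?S" if "x \<in> ?E" for x
      using that C(2) subspace_0[OF U(1)] by (intro CollectI exI[of _ 0] exI[of _ x]) auto
    ultimately show ?thesis by blast
  qed
  ultimately have "dim ?S = card B + card ?E"
    using ind[of ?E] finC by (intro dim_unique) auto
  moreover have "card ?E + card B' = card C"
    using card_Diff_subset[OF finite_subset[OF C(1) finC] C(1)] card_mono[OF finC C(1)] by simp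
  ultimately show ?thesis using B(4) B'(4) dimV' by simp
qed

lemma kscale_eq: "kscale c p = Poly_Mapping.single 0 c * p"
  by (simp add: kscale_def mult_map_scale_conv_mult)

lemma lookup_kscale: "lk (kscale c p) \<alpha> = c * lk p \<alpha>"
  by (simp add: kscale_def Poly_Mapping.map.rep_eq when_def)

interpretation kv: vector_space kscale
  by unfold_locales
    (auto simp: kscale_eq algebra_simps single_add mult_single simp flip: mult.assoc)

lemma linear_times: "Vector_Spaces.linear kscale kscale (\<lambda>p. (f :: 'k::field mpoly) * p)"
  unfolding Vector_Spaces.linear_iff
  by (auto simp: kscale_eq algebra_simps kv.vector_space_axioms)

lemma span_monom: "kv.span (monom ` M :: 'k::field mpoly set) = {p. keys p \<subseteq> M}"
proof
  have "kv.subspace {p :: 'k mpoly. keys p \<subseteq> M}"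
  proof (rule kv.subspaceI)
    show "p + q \<in> {p. keys p \<subseteq> M}" if "p \<in> {p. keys p \<subseteq> M}" "q \<in> {p. keys p \<subseteq> M}" for p q :: "'k mpoly"
      using that keys_add[of p q] by auto
  qed (auto simp: in_keys_iff lookup_kscale subset_iff)
  then show "kv.span (monom ` M) \<subseteq> {p :: 'k mpoly. keys p \<subseteq> M}"
    by (intro kv.span_minimal) auto
next
  show "{p :: 'k mpoly. keys p \<subseteq> M} \<subseteq> kv.span (monom ` M)"
  proof
    fix p :: "'k mpoly" assume p: "p \<in> {p. keys p \<subseteq> M}"
    have "p = (\<Sum>\<alpha>\<in>keys p. kscale (lk p \<alpha>) (monom \<alpha>))"
      by (simp add: kscale_eq monom_def mult_single poly_mapping_sum_singles)
    also have "\<dots> \<in> kv.span (monom ` M)"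
      using p by (intro kv.span_sum kv.span_scale kv.span_base) auto
    finally show "p \<in> kv.span (monom ` M)" .
  qed
qed

lemma kdim_keys:
  assumes "finite M"
  shows "kdim {p :: 'k::field mpoly. keys p \<subseteq> M} = card M"
proof -
  have "kv.independent (monom ` M :: 'k mpoly set)"
  proof (rule kv.independent_if_scalars_zero)
    fix g :: "'k mpoly \<Rightarrow> 'k" and x :: "'k mpoly"
    assume sum: "(\<Sum>x\<in>monom ` M. kscale (g x) x) = 0" and "x \<in> monom ` M"
    then obtain \<alpha> where \<alpha>: "\<alpha> \<in> M" "x = monom \<alpha>" by blast
    have "(\<Sum>\<beta>\<in>M. kscale (g (monom \<beta>)) (monom \<beta>)) = 0"
      using sum by (subst (asm) sum.reindex) (auto intro: inj_on_subset[OF inj_monom])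
    then have "(\<Sum>\<beta>\<in>M. lk (kscale (g (monom \<beta>)) (monom \<beta>)) \<alpha>) = 0"
      by (metis lookup_sum lookup_zero)
    then show "g x = 0"
      using \<alpha> assms by (simp add: lookup_kscale monom_def lookup_single when_def if_distrib cong: if_cong)
  qed (use assms in simp)
  then have "kv.dim (kv.span (monom ` M :: 'k mpoly set)) = card (monom ` M :: 'k mpoly set)"
    by (simp add: kv.dim_eq_card_independent)
  also have "\<dots> = card M" by (intro card_image inj_on_subset[OF inj_monom]) auto
  finally show ?thesis by (simp add: span_monom kdim_def)
qed

section \<open>Monomials in a box and the Hilbert function of a regular sequence\<close>

definition Mon :: "nat \<Rightarrow> nat \<Rightarrow> (nat \<Rightarrow>\<^sub>0 nat) set" where
  "Mon n j = {\<alpha>. mvars_in n \<alpha> \<and> mdeg \<alpha> = j}"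

text \<open>The parameter \<open>h\<close> is kept apart from \<open>n\<close> so that exponents are
  bounded one variable at a time, in step with a regular sequence.\<close>

definition Box :: "nat \<Rightarrow> nat \<Rightarrow> (nat \<Rightarrow> nat) \<Rightarrow> nat \<Rightarrow> (nat \<Rightarrow>\<^sub>0 nat) set" where
  "Box n h d j = {\<alpha> \<in> Mon n j. \<forall>i<h. lk \<alpha> i < d i}"

lemma finite_Mon [simp]: "finite (Mon n j)"
  by (simp add: Mon_def finite_monomials)

lemma finite_Box [simp]: "finite (Box n h d j)"
  by (simp add: Box_def)

lemma hom_comp_keys: "hom_comp n j = {p. keys p \<subseteq> Mon n j}"
  by (auto simp: hom_comp_def polyring_def Mon_def)

lemma hom_comp_span: "hom_comp n j \<subseteq> kv.span (monom ` Mon n j :: 'k::field mpoly set)"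
  by (simp add: span_monom hom_comp_keys)

lemma subspace_hom_comp: "kv.subspace (hom_comp n j)"
  using kv.subspace_span[of "monom ` Mon n j"] by (simp only: span_monom hom_comp_keys)

lemma subspace_ideal:
  assumes "is_ideal n I"
  shows "kv.subspace (I \<inter> hom_comp n j)"
proof -
  have "kv.subspace I"
    by (rule kv.subspaceI) (auto simp: kscale_eq ideal_0[OF assms] intro: ideal_add[OF assms]
      intro!: ideal_mult[OF assms] polyring_single)
  then show ?thesis using subspace_hom_comp by (rule kv.subspace_inter)
qed

lemma kdim_mono:
  assumes "V \<subseteq> W" "W \<subseteq> hom_comp n j"
  shows "kdim V \<le> kdim W"
  unfolding kdim_def
  using assms hom_comp_span[of n j] kv.span_superset[of W]
  by (intro kv.dim_mono_finite[of V W "monom ` Mon n j"]) auto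

lemma HF_quot_add:
  fixes I :: "'k::field mpoly set"
  shows "HF_quot n I j + kdim (I \<inter> hom_comp n j) = kdim (hom_comp n j :: 'k mpoly set)"
  unfolding HF_quot_def using kdim_mono[of "I \<inter> hom_comp n j" "hom_comp n j" n j] by simp

text \<open>Multiplication by the \<open>d h\<close>-th power of variable \<open>h\<close> maps the
  last box bijectively onto the monomials lost by bounding exponent \<open>h\<close>; that exponent
  is still free in \<open>Box n h\<close>.\<close>

lemma Box_Suc_card:
  assumes "h < n" "d h \<le> m"
  shows "card (Box n h d m) = card (Box n (Suc h) d m) + card (Box n h d (m - d h))"
proof -
  let ?s = "Poly_Mapping.single h (d h)"
  have "Box n h d m = Box n (Suc h) d m \<union> (\<lambda>\<alpha>. \<alpha> + ?s) ` Box n h d (m - d h)"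
  proof (intro subset_antisym subsetI)
    fix \<alpha> assume \<alpha>: "\<alpha> \<in> Box n h d m"
    show "\<alpha> \<in> Box n (Suc h) d m \<union> (\<lambda>\<alpha>. \<alpha> + ?s) ` Box n h d (m - d h)"
    proof (cases "lk \<alpha> h < d h")
      case True
      then show ?thesis using \<alpha> by (auto simp: Box_def less_Suc_eq)
    next
      case False
      define \<beta> where "\<beta> = \<alpha> - ?s"
      have eq: "\<alpha> = \<beta> + ?s"
        using False by (intro poly_mapping_eqI)
          (auto simp: \<beta>_def lookup_add lookup_minus lookup_single when_def)
      have "\<beta> \<in> Box n h d (m - d h)"
        using \<alpha> assms unfolding eq by (auto simp: Box_def Mon_def mdeg_add lookup_add lookup_single)
      then show ?thesis using eq by blast
    qed
  next
    fix \<alpha> assume "\<alpha> \<in> Box n (Suc h) d m \<union> (\<lambda>\<alpha>. \<alpha> + ?s) ` Box n h d (m - d h)"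
    then show "\<alpha> \<in> Box n h d m"
      using assms by (auto simp: Box_def Mon_def mdeg_add lookup_add lookup_single when_def)
  qed
  moreover have "Box n (Suc h) d m \<inter> (\<lambda>\<alpha>. \<alpha> + ?s) ` Box n h d (m - d h) = {}"
    by (auto simp: Box_def lookup_add)
  ultimately show ?thesis
    by (simp add: card_Un_disjoint card_image inj_on_def)
qed

lemma Box_Suc_eq: "m < d h \<Longrightarrow> Box n (Suc h) d m = Box n h d m"
proof -
  assume m: "m < d h"
  have "lk \<alpha> h \<le> mdeg \<alpha>" for \<alpha>
  proof (cases "h \<in> keys \<alpha>")
    case True
    then show ?thesis unfolding mdeg_def by (intro member_le_sum) auto
  qed (simp add: in_keys_iff)
  then have "lk \<alpha> h < d h" if "mdeg \<alpha> = m" for \<alpha> using m that le_less_trans by blast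
  then show ?thesis by (auto simp: Box_def Mon_def less_Suc_eq)
qed

text \<open>Multiplication by \<open>f h\<close> is injective modulo the earlier elements, so the
  Hilbert function of the quotient obeys the recursion of the box counts. It depends on
  \<open>d\<close> alone, which makes \<open>(f)\<close> comparable with the monomial ideal.\<close>

lemma kdim_regular_sequence:
  fixes f :: "nat \<Rightarrow> 'k::field mpoly"
  assumes fh: "\<And>i. i < n \<Longrightarrow> f i \<in> hom_comp n (d i)"
    and freg: "regular_sequence n n f"
    and "h \<le> n"
  shows "kdim (hom_comp n m :: 'k mpoly set)
    = kdim (ideal_gen n (f ` {..<h}) \<inter> hom_comp n m) + card (Box n h d m)"
  using \<open>h \<le> n\<close>
proof (induction h arbitrary: m)
  case 0
  have "kdim {0 :: 'k mpoly} = 0"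
    using kv.dim_unique[of "{}" "{0}" 0] by (simp add: kdim_def kv.independent_empty)
  moreover have "{0} \<inter> hom_comp n m = {0 :: 'k mpoly}" by (auto simp: hom_comp_keys)
  ultimately show ?case by (simp add: hom_comp_keys kdim_keys Box_def)
next
  case (Suc h)
  let ?I = "ideal_gen n (f ` {..<h})" and ?J = "ideal_gen n (f ` {..<Suc h})"
  have h: "h < n" using Suc.prems by simp
  have fR: "f i \<in> polyring n" if "i < n" for i using freg that by (simp add: regular_sequence_def)
  then have fR': "f ` {..<h} \<subseteq> polyring n" "f h \<in> polyring n" using h by auto
  note I = is_ideal_gen[OF fR'(1)]
  have mem: "p \<in> ?J \<longleftrightarrow> (\<exists>u\<in>?I. \<exists>v\<in>polyring n. p = u + f h * v)" for p
    using ideal_gen_insert[OF fR'] by (simp add: lessThan_Suc)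
  have fhom: "f i \<in> hom_int n (int (d i))" if "i < n" for i using fh[OF that] by (simp add: hom_int_of_nat)
  have hI: "hpart e p \<in> ?I" if "p \<in> ?I" for e p
    by (rule hpart_ideal_gen[OF fR'(1) _ that]) (use fhom h less_trans in blast)
  have split: "\<exists>u\<in>?I \<inter> hom_comp n m. \<exists>v\<in>hom_int n (int m - int (d h)). p = u + f h * v"
    if p: "p \<in> ?J \<inter> hom_comp n m" for p
  proof -
    from p mem obtain u v where uv: "u \<in> ?I" "v \<in> polyring n" "p = u + f h * v" by blast
    have "p = hpart (int m) p" using p hpart_id[of p n "int m"] by (simp add: hom_int_of_nat)
    also have "\<dots> = hpart (int m) u + f h * hpart (int m - int (d h)) v"
      by (simp add: uv(3) hpart_add hpart_mult[OF fhom[OF h]])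
    finally have "p = hpart (int m) u + f h * hpart (int m - int (d h)) v" .
    moreover have "hpart (int m) u \<in> hom_comp n m"
      using hpart_in_hom_int[of u n "int m"] ideal_polyring[OF I uv(1)] by (simp add: hom_int_of_nat)
    ultimately show ?thesis using hI[OF uv(1)] hpart_in_hom_int[OF uv(2)] by blast
  qed
  have sub: "?I \<subseteq> ?J" by (rule ideal_gen_mono) auto
  show ?case
  proof (cases "d h \<le> m")
    case False
    \<comment> \<open>Below degree \<open>d h\<close> the coefficient of \<open>f h\<close> would
      have negative degree, so the ideal does not grow.\<close>
    then have "v = 0" if "v \<in> hom_int n (int m - int (d h))" for v :: "'k mpoly"
      using hom_int_neg[OF that] by simp
    then have "?J \<inter> hom_comp n m = ?I \<inter> hom_comp n m"
      using split sub by fastforce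
    then show ?thesis using Suc.IH[of m] Box_Suc_eq[of m d h n] False Suc.prems by simp
  next
    case True
    let ?V = "hom_comp n (m - d h) :: 'k mpoly set"
    have shift: "int m - int (d h) = int (m - d h)" using True by simp
    have "?J \<inter> hom_comp n m = {u + f h * v |u v. u \<in> ?I \<inter> hom_comp n m \<and> v \<in> ?V}"
    proof (intro subset_antisym subsetI)
      fix p assume "p \<in> ?J \<inter> hom_comp n m"
      from split[OF this] show "p \<in> {u + f h * v |u v. u \<in> ?I \<inter> hom_comp n m \<and> v \<in> ?V}"
        unfolding shift hom_int_of_nat by blast
    next
      fix p assume "p \<in> {u + f h * v |u v. u \<in> ?I \<inter> hom_comp n m \<and> v \<in> ?V}"
      then obtain u v where uv: "p = u + f h * v" "u \<in> ?I" "u \<in> hom_comp n m" "v \<in> ?V" by blast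
      have "f h * v \<in> hom_comp n m" using hom_comp_mult[OF fh[OF h] uv(4)] True by simp
      then have "p \<in> hom_comp n m"
        unfolding uv(1) using uv(3) subspace_hom_comp kv.subspace_add by blast
      moreover have "p \<in> ?J" using uv mem by (auto simp: hom_comp_def)
      ultimately show "p \<in> ?J \<inter> hom_comp n m" by blast
    qed
    moreover have "kv.dim {u + f h * v |u v. u \<in> ?I \<inter> hom_comp n m \<and> v \<in> ?V}
        + kv.dim (?I \<inter> ?V) = kv.dim (?I \<inter> hom_comp n m) + kv.dim ?V"
    proof (rule kv.dim_sum_image[OF linear_times subspace_ideal[OF I] _ _ subspace_hom_comp
          hom_comp_span _ subspace_ideal[OF I]])
      show "?I \<inter> hom_comp n m \<subseteq> kv.span (monom ` Mon n m)" using hom_comp_span[of n m] by blast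
      fix v assume v: "v \<in> ?V"
      have vR: "v \<in> polyring n" using v by (simp add: hom_comp_def)
      have "v \<in> ?I" if "f h * v \<in> ?I"
        using freg h vR that by (auto simp: regular_sequence_def mult.commute)
      moreover have "f h * v \<in> hom_comp n m" using hom_comp_mult[OF fh[OF h] v] True by simp
      ultimately show "f h * v \<in> ?I \<inter> hom_comp n m \<longleftrightarrow> v \<in> ?I \<inter> ?V"
        using v ideal_mult[OF I fR'(2)] by blast
    qed auto
    ultimately have "kdim (?J \<inter> hom_comp n m) + kdim (?I \<inter> ?V) = kdim (?I \<inter> hom_comp n m) + kdim ?V"
      by (simp add: kdim_def)
    then show ?thesis
      using Suc.IH[of m] Suc.IH[of "m - d h"] Box_Suc_card[of h n d m] h True Suc.prems by simp
  qed
qed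

section \<open>Monomial ideals\<close>

lemma ideal_gen_monom:
  assumes X: "\<And>\<alpha>. \<alpha> \<in> X \<Longrightarrow> mvars_in n \<alpha>"
  shows "p \<in> ideal_gen n (monom ` X :: 'k::field mpoly set)
    \<longleftrightarrow> p \<in> polyring n \<and> (\<forall>\<alpha>\<in>keys p. \<exists>\<beta>\<in>X. \<exists>\<gamma>. \<alpha> = \<gamma> + \<beta>)" (is "_ \<longleftrightarrow> p \<in> polyring n \<and> ?P p")
proof
  let ?I = "{p :: 'k mpoly. p \<in> polyring n \<and> ?P p}"
  have "is_ideal n ?I"
  proof (rule is_idealI)
    show "p + q \<in> ?I" if "p \<in> ?I" "q \<in> ?I" for p q
      using that keys_add[of p q] by auto
    show "r * p \<in> ?I" if "r \<in> polyring n" and p: "p \<in> ?I" for r p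
    proof -
      have "\<exists>\<beta>\<in>X. \<exists>\<gamma>. \<alpha> = \<gamma> + \<beta>" if rp: "\<alpha> \<in> keys (r * p)" for \<alpha>
      proof -
        obtain a b where "\<alpha> = a + b" "b \<in> keys p" using rp keys_mult[of r p] by blast
        moreover from this obtain \<beta> \<gamma> where "\<beta> \<in> X" "b = \<gamma> + \<beta>" using p by blast
        ultimately have "\<beta> \<in> X" "\<alpha> = (a + \<gamma>) + \<beta>" by (auto simp: add.assoc)
        then show ?thesis by blast
      qed
      then show ?thesis using that by simp
    qed
  qed auto
  moreover have "monom ` X \<subseteq> ?I"
  proof
    fix b :: "'k mpoly" assume "b \<in> monom ` X"
    then obtain \<alpha> where \<alpha>: "\<alpha> \<in> X" "b = monom \<alpha>" by blast
    then show "b \<in> ?I" using X by (auto intro!: polyring_monom bexI[of _ \<alpha>] exI[of _ 0])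
  qed
  ultimately have "ideal_gen n (monom ` X) \<subseteq> ?I" by (rule ideal_gen_least)
  then show "p \<in> polyring n \<and> ?P p" if "p \<in> ideal_gen n (monom ` X)"
    using that by blast
next
  assume p: "p \<in> polyring n \<and> ?P p"
  have XR: "(monom ` X :: 'k mpoly set) \<subseteq> polyring n" using X by (auto intro: polyring_monom)
  note I = is_ideal_gen[OF XR]
  have "Poly_Mapping.single \<alpha> (lk p \<alpha>) \<in> ideal_gen n (monom ` X)" if \<alpha>: "\<alpha> \<in> keys p" for \<alpha>
  proof -
    obtain \<beta> \<gamma> where bg: "\<beta> \<in> X" "\<alpha> = \<gamma> + \<beta>" using p \<alpha> by blast
    have "mvars_in n \<alpha>" using p \<alpha> by (simp add: polyring_def)
    then have "mvars_in n \<gamma>" using bg by simp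
    then have "Poly_Mapping.single \<gamma> (lk p \<alpha>) * monom \<beta> \<in> ideal_gen n (monom ` X)"
      using bg(1) by (intro ideal_mult[OF I] polyring_single ideal_gen_base imageI)
    then show ?thesis by (simp add: bg(2) monom_def mult_single)
  qed
  then have "(\<Sum>\<alpha>\<in>keys p. Poly_Mapping.single \<alpha> (lk p \<alpha>)) \<in> ideal_gen n (monom ` X)"
    by (rule ideal_sum[OF I])
  then show "p \<in> ideal_gen n (monom ` X)" by (simp add: poly_mapping_sum_singles)
qed

lemma divides_single_iff:
  "(\<exists>\<gamma>. \<alpha> = \<gamma> + Poly_Mapping.single i e) \<longleftrightarrow> e \<le> lk \<alpha> i" for \<alpha> :: "nat \<Rightarrow>\<^sub>0 nat"
proof
  assume "e \<le> lk \<alpha> i"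
  then have "\<alpha> = (\<alpha> - Poly_Mapping.single i e) + Poly_Mapping.single i e"
    by (intro poly_mapping_eqI) (auto simp: lookup_add lookup_minus lookup_single when_def)
  then show "\<exists>\<gamma>. \<alpha> = \<gamma> + Poly_Mapping.single i e" by blast
qed (auto simp: lookup_add)

lemma pow_ideal_iff:
  "p \<in> pow_ideal n d \<longleftrightarrow> p \<in> polyring n \<and> (\<forall>\<alpha>\<in>keys p. \<exists>i<n. d i \<le> lk \<alpha> i)"
proof -
  have eq: "(\<lambda>i. varpow i (d i)) ` {..<n} = monom ` ((\<lambda>i. Poly_Mapping.single i (d i)) ` {..<n})"
    by (simp add: varpow_def image_image)
  then show ?thesis
    unfolding pow_ideal_def eq by (subst ideal_gen_monom) (auto simp: divides_single_iff)
qed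

lemma monom_notin_pow_ideal:
  "mvars_in n \<alpha> \<and> mdeg \<alpha> = E \<and> (monom \<alpha> :: 'k::field mpoly) \<notin> pow_ideal n d \<longleftrightarrow> \<alpha> \<in> Box n n d E"
  by (auto simp: Box_def Mon_def pow_ideal_iff polyring_monom not_le)

lemma kdim_pow_ideal:
  "kdim (pow_ideal n d \<inter> hom_comp n m :: 'k::field mpoly set) = card (Mon n m - Box n n d m)"
proof -
  have key: "\<alpha> \<in> Mon n m - Box n n d m \<longleftrightarrow> \<alpha> \<in> Mon n m \<and> (\<exists>i<n. d i \<le> lk \<alpha> i)" for \<alpha>
    by (auto simp: Box_def not_less)
  have "pow_ideal n d \<inter> hom_comp n m = {p :: 'k mpoly. keys p \<subseteq> Mon n m - Box n n d m}"
    unfolding set_eq_iff Int_iff pow_ideal_iff mem_Collect_eq subset_iff key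
    by (auto simp: hom_comp_def polyring_def Mon_def)
  then show ?thesis by (simp add: kdim_keys)
qed

lemma HF_pow_ideal: "HF_quot n (pow_ideal n d :: 'k::field mpoly set) m = card (Box n n d m)"
proof -
  have "Box n n d m \<subseteq> Mon n m" by (auto simp: Box_def)
  then have "card (Mon n m - Box n n d m) + card (Box n n d m) = card (Mon n m)"
    by (simp add: card_Diff_subset card_mono)
  moreover have "kdim (hom_comp n m :: 'k mpoly set) = card (Mon n m)"
    by (simp add: hom_comp_keys kdim_keys)
  ultimately show ?thesis using HF_quot_add[of n "pow_ideal n d :: 'k mpoly set" m]
    by (simp add: kdim_pow_ideal)
qed

lemma mdeg_Box_le:
  assumes "\<alpha> \<in> Box n n d m"
  shows "m \<le> sigma n d"
proof -
  have "m = (\<Sum>i<n. lk \<alpha> i)" using assms by (auto simp: Box_def Mon_def mdeg_mvars)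
  also have "\<dots> \<le> sigma n d" unfolding sigma_def using assms
    by (intro sum_mono) (auto simp: Box_def less_eq_Suc_le)
  finally show ?thesis .
qed

text \<open>The length of the monomial complete intersection, and the source of the product in the
  multiplicity bound: an exponent vector chooses one of \<open>d i\<close> values for each
  \<open>i\<close>.\<close>

lemma sum_card_Box: "(\<Sum>m\<le>sigma n d. card (Box n n d m)) = (\<Prod>i<n. d i)"
proof -
  let ?B = "{\<alpha>. mvars_in n \<alpha> \<and> (\<forall>i<n. lk \<alpha> i < d i)}"
  let ?r = "\<lambda>\<alpha> :: nat \<Rightarrow>\<^sub>0 nat. restrict (lk \<alpha>) {..<n}"
  have "(\<Sum>m\<le>sigma n d. card (Box n n d m)) = card (\<Union>m\<le>sigma n d. Box n n d m)"
  proof (rule card_UN_disjoint[symmetric])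
    show "\<forall>i\<in>{..sigma n d}. \<forall>j\<in>{..sigma n d}. i \<noteq> j \<longrightarrow> Box n n d i \<inter> Box n n d j = {}"
      by (auto simp: Box_def Mon_def)
  qed auto
  also have "(\<Union>m\<le>sigma n d. Box n n d m) = ?B"
    using mdeg_Box_le by (fastforce simp: Box_def Mon_def)
  also have "card ?B = card (PiE {..<n} (\<lambda>i. {..<d i}))"
  proof (rule bij_betw_same_card[of ?r])
    show "bij_betw ?r ?B (PiE {..<n} (\<lambda>i. {..<d i}))"
    proof (rule bij_betw_imageI)
      show "inj_on ?r ?B"
      proof (rule inj_onI)
        fix \<alpha> \<beta> assume ab: "\<alpha> \<in> ?B" "\<beta> \<in> ?B" "?r \<alpha> = ?r \<beta>"
        show "\<alpha> = \<beta>"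
        proof (rule poly_mapping_eqI)
          fix i
          show "lk \<alpha> i = lk \<beta> i"
            using ab(1,2) fun_cong[OF ab(3), of i] by (cases "i < n") (auto simp: mvars_in_def not_less)
        qed
      qed
      show "?r ` ?B = PiE {..<n} (\<lambda>i. {..<d i})"
      proof (intro subset_antisym subsetI)
        fix g assume g: "g \<in> PiE {..<n} (\<lambda>i. {..<d i})"
        define \<alpha> where "\<alpha> = (\<Sum>i<n. Poly_Mapping.single i (g i))"
        have lk: "lk \<alpha> i = (if i < n then g i else 0)" for i
          by (simp add: \<alpha>_def lookup_sum lookup_single when_def)
        have "?r \<alpha> = g" using g by (auto simp: lk fun_eq_iff PiE_iff extensional_def)
        moreover have "\<alpha> \<in> ?B" using g by (auto simp: lk mvars_in_def PiE_iff)
        ultimately show "g \<in> ?r ` ?B" by blast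
      next
        fix g assume "g \<in> ?r ` ?B"
        then obtain \<alpha> where "\<forall>i<n. lk \<alpha> i < d i" "g = ?r \<alpha>" by blast
        then show "g \<in> PiE {..<n} (\<lambda>i. {..<d i})" by (simp add: restrict_PiE_iff)
      qed
    qed
  qed
  also have "\<dots> = (\<Prod>i<n. d i)" by (simp add: card_PiE)
  finally show ?thesis .
qed

section \<open>The lex-largest monomial outside the power ideal\<close>

lemma lex_gt_iff: "lex_gt \<alpha> \<beta> \<longleftrightarrow> \<beta> < \<alpha>"
  by (auto simp: lex_gt_def less_poly_mapping.rep_eq less_fun_def)

text \<open>\<open>lex_gt\<close> is the linear order that exponent vectors already carry, so the
  definite description is the \<open>Max\<close> of a finite nonempty box.\<close>

lemma U_exp_Box:
  assumes "Box n n d E \<noteq> {}"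
  shows U_exp_in_Box: "U_exp TYPE('k::field) n d E \<in> Box n n d E"
    and U_exp_max: "\<beta> \<in> Box n n d E \<Longrightarrow> \<beta> \<le> U_exp TYPE('k) n d E"
proof -
  let ?P = "\<lambda>\<alpha>. \<alpha> \<in> Box n n d E \<and> (\<forall>\<beta>. \<beta> \<in> Box n n d E \<and> \<beta> \<noteq> \<alpha> \<longrightarrow> \<beta> < \<alpha>)"
  have "U_exp TYPE('k) n d E = (THE \<alpha>. ?P \<alpha>)"
    unfolding U_exp_def lex_gt_iff by (simp flip: monom_notin_pow_ideal[where 'k = 'k] conj_assoc)
  also have "\<dots> = Max (Box n n d E)"
  proof (rule the_equality)
    show "?P (Max (Box n n d E))" using assms by (auto intro: le_neq_trans)
    show "\<alpha> = Max (Box n n d E)" if "?P \<alpha>" for \<alpha>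
      using that assms by (intro Max_eqI[symmetric]) (auto intro: less_imp_le)
  qed
  finally have "U_exp TYPE('k) n d E = Max (Box n n d E)" .
  then show "U_exp TYPE('k::field) n d E \<in> Box n n d E"
    and "\<beta> \<in> Box n n d E \<Longrightarrow> \<beta> \<le> U_exp TYPE('k) n d E"
    using assms by auto
qed

text \<open>Exchange argument: if exponent \<open>i\<close> were not maximal, moving one unit to
  variable \<open>i\<close> from a later variable would give a lex-larger monomial in the box. The
  hypothesis on \<open>w\<close> says that the first \<open>w\<close> exponents can absorb at most
  degree \<open>E\<close>.\<close>

lemma U_exp_prefix:
  assumes ne: "Box n n d E \<noteq> {}" and w: "w \<le> n" "(\<Sum>s<w. d s) \<le> E + w" and i: "i < w"
  shows "Suc (lk (U_exp TYPE('k::field) n d E) i) = d i"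
proof (rule ccontr)
  let ?U = "U_exp TYPE('k) n d E"
  note U = U_exp_in_Box[OF ne, where 'k = 'k]
  assume "Suc (lk ?U i) \<noteq> d i"
  then have Ui: "Suc (lk ?U i) < d i" using U i w(1) by (auto simp: Box_def less_Suc_eq_le intro: le_neq_trans simp: Suc_le_eq)
  have lt: "lk ?U s < d s" if "s < n" for s using U that by (simp add: Box_def)
  \<comment> \<open>Otherwise the monomial would live on the first \<open>w\<close> variables with
    slack at \<open>i\<close>, and its degree would fall below \<open>E\<close>.\<close>
  have "\<exists>j. i < j \<and> j < n \<and> 0 < lk ?U j"
  proof (rule ccontr)
    assume no: "\<not> ?thesis"
    have "E = (\<Sum>s<n. lk ?U s)" using U by (auto simp: Box_def Mon_def mdeg_mvars)
    also have "\<dots> = (\<Sum>s<w. lk ?U s)"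
      using no w(1) i by (intro sum.mono_neutral_right) auto
    also have "\<dots> < (\<Sum>s<w. d s - 1)"
    proof (rule sum_strict_mono_ex1)
      show "\<forall>s\<in>{..<w}. lk ?U s \<le> d s - 1"
      proof
        fix s assume "s \<in> {..<w}"
        then show "lk ?U s \<le> d s - 1" using lt[of s] w(1) by simp
      qed
      show "\<exists>s\<in>{..<w}. lk ?U s < d s - 1" using Ui i by (intro bexI[of _ i]) auto
    qed simp
    also have "\<dots> = (\<Sum>s<w. d s) - w"
    proof (subst sum_subtractf_nat)
      show "1 \<le> d s" if "s \<in> {..<w}" for s using lt[of s] w(1) that by simp
    qed simp
    also have "\<dots> \<le> E" using w(2) by simp
    finally show False by simp
  qed
  then obtain j where j: "i < j" "j < n" "0 < lk ?U j" by blast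
  define \<beta> where "\<beta> = (?U - Poly_Mapping.single j 1) + Poly_Mapping.single i 1"
  have U_eq: "?U = (?U - Poly_Mapping.single j 1) + Poly_Mapping.single j 1"
    using j(3) by (intro poly_mapping_eqI) (auto simp: lookup_add lookup_minus lookup_single when_def)
  have lk_beta: "lk \<beta> s = (if s = i then Suc (lk ?U i) else if s = j then lk ?U j - 1 else lk ?U s)" for s
    using j by (auto simp: \<beta>_def lookup_add lookup_minus lookup_single when_def)
  have "mdeg \<beta> = mdeg ?U"
    by (subst U_eq) (simp add: \<beta>_def mdeg_add)
  moreover have "mvars_in n \<beta>" using U j by (auto simp: mvars_in_def lk_beta Box_def Mon_def)
  moreover have "lk \<beta> s < d s" if "s < n" for s
    using Ui lt[OF that] by (auto simp: lk_beta less_imp_diff_less)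
  ultimately have "\<beta> \<in> Box n n d E" using U by (auto simp: Box_def Mon_def)
  then have "\<beta> \<le> ?U" by (rule U_exp_max[OF ne])
  moreover have "lex_gt \<beta> ?U"
    unfolding lex_gt_def using j(1) by (intro exI[of _ i]) (auto simp: lk_beta)
  ultimately show False by (simp add: lex_gt_iff)
qed

lemma phi_le:
  assumes ne: "Box n n d E \<noteq> {}" and w: "w \<le> n" "(\<Sum>s<w. d s) \<le> E + w"
  shows "phi TYPE('k::field) n d (Suc E) \<le> int (n - w)"
proof -
  let ?U = "U_exp TYPE('k) n d E" and ?m = "Suc E"
  let ?L = "lex_L n d E :: 'k mpoly set" and ?P = "pow_ideal n d :: 'k mpoly set"
  let ?X = "insert ?U ((\<lambda>i. Poly_Mapping.single i (d i)) ` {..<n})"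
  \<comment> \<open>\<open>?M\<close> encloses the monomials of the lex ideal in degree
    \<open>E + 1\<close>; an upper bound on their number is all that the comparison asks
    for.\<close>
  let ?M = "(Mon n ?m - Box n n d ?m) \<union> (\<lambda>i. ?U + Poly_Mapping.single i (Suc 0)) ` {w..<n}"
  note U = U_exp_in_Box[OF ne, where 'k = 'k]
  have L: "?L = ideal_gen n (monom ` ?X)"
    by (simp add: lex_L_def varpow_def image_image)
  have X: "mvars_in n \<alpha>" if "\<alpha> \<in> ?X" for \<alpha>
    using that U by (auto simp: Box_def Mon_def)
  have "keys p \<subseteq> ?M" if p: "p \<in> ?L \<inter> hom_comp n ?m" for p :: "'k mpoly"
  proof
    fix \<alpha> assume \<alpha>: "\<alpha> \<in> keys p"
    then have a: "mvars_in n \<alpha>" "mdeg \<alpha> = ?m" using p by (auto simp: hom_comp_def polyring_def)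
    have "p \<in> ideal_gen n (monom ` ?X)" using p L by blast
    then have "\<forall>\<alpha>\<in>keys p. \<exists>\<beta>\<in>?X. \<exists>\<gamma>. \<alpha> = \<gamma> + \<beta>" using ideal_gen_monom[OF X] by blast
    then obtain \<beta> \<gamma> where bg: "\<beta> \<in> ?X" "\<alpha> = \<gamma> + \<beta>" using \<alpha> by meson
    show "\<alpha> \<in> ?M"
    proof (cases "\<alpha> \<in> Box n n d ?m")
      case True
      then have "\<not> d i \<le> lk \<alpha> i" if "i < n" for i using that by (simp add: Box_def not_le)
      \<comment> \<open>A monomial in the box is divisible by no power generator, so the generator
        dividing it is \<open>?U\<close>, and the degrees leave a single variable as
        cofactor.\<close>
      then have "\<beta> = ?U" using bg divides_single_iff[of \<alpha>] by blast
      then have "mdeg \<gamma> = 1" using a(2) U bg(2) by (simp add: mdeg_add Box_def Mon_def)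
      then obtain i where i: "\<gamma> = Poly_Mapping.single i (Suc 0)" by (rule mdeg_eq_1E)
      have \<alpha>_eq: "\<alpha> = ?U + Poly_Mapping.single i (Suc 0)"
        using bg(2) i \<open>\<beta> = ?U\<close> by (simp add: add.commute)
      have "i < n" using a(1) unfolding \<alpha>_eq by simp
      moreover have "\<not> i < w"
      proof
        assume "i < w"
        then have "d i \<le> lk \<alpha> i"
          using U_exp_prefix[OF ne w, of i, where 'k = 'k] by (simp add: \<alpha>_eq lookup_add)
        then show False using True \<open>i < n\<close> by (simp add: Box_def not_less[symmetric])
      qed
      ultimately show ?thesis using \<alpha>_eq by auto
    qed (use a in \<open>simp add: Mon_def\<close>)
  qed
  then have sub: "?L \<inter> hom_comp n ?m \<subseteq> {p. keys p \<subseteq> ?M}" by blast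
  have M: "{p :: 'k mpoly. keys p \<subseteq> ?M} \<subseteq> hom_comp n ?m"
    using U by (auto simp: hom_comp_keys Mon_def Box_def mdeg_add subset_iff)
  have "kdim (?L \<inter> hom_comp n ?m) \<le> card ?M"
    using kdim_mono[OF sub M] by (simp add: kdim_keys)
  also have "\<dots> \<le> card (Mon n ?m - Box n n d ?m) + card ((\<lambda>i. ?U + Poly_Mapping.single i (Suc 0)) ` {w..<n})"
    by (rule card_Un_le)
  also have "\<dots> \<le> kdim (?P \<inter> hom_comp n ?m) + (n - w)"
    using card_image_le[of "{w..<n}" "\<lambda>i. ?U + Poly_Mapping.single i (Suc 0)"]
    by (simp add: kdim_pow_ideal)
  finally show ?thesis
    using HF_quot_add[of n ?L ?m] HF_quot_add[of n ?P ?m] by (simp add: phi_def)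
qed

section \<open>Almost complete intersections\<close>

text \<open>The variables \<^term>\<open>i \<notin> A\<close> below give linear forms annihilating \<^term>\<open>G\<close> modulo the regular
  sequence; they are in echelon form because \<^term>\<open>A\<close> indexes a maximal independent set of multiples.\<close>

lemma kdim_growth:
  fixes f :: "nat \<Rightarrow> 'k::field mpoly"
  assumes fh: "\<And>i. i < n \<Longrightarrow> f i \<in> hom_comp n (d i)"
    and freg: "regular_sequence n n f"
    and sorted: "\<And>i j. i \<le> j \<Longrightarrow> j < n \<Longrightarrow> d i \<le> d j"
    and G: "G \<in> hom_comp n e" "G \<notin> ideal_gen n (f ` {..<n})"
    and J: "is_ideal n J" "ideal_gen n (f ` {..<n}) \<subseteq> J" "G \<in> J"
  shows "\<exists>w\<le>n. (\<Sum>s<w. d s) \<le> e + w \<and>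
    kdim (ideal_gen n (f ` {..<n}) \<inter> hom_comp n (Suc e)) + (n - w) \<le> kdim (J \<inter> hom_comp n (Suc e))"
proof -
  let ?I = "ideal_gen n (f ` {..<n})"
  let ?U = "?I \<inter> hom_comp n (Suc e)" and ?V = "J \<inter> hom_comp n (Suc e)"
  let ?g = "\<lambda>i. var i * G"
  have "f ` {..<n} \<subseteq> polyring n" using freg by (auto simp: regular_sequence_def)
  note I = is_ideal_gen[OF this]
  have G0: "G \<noteq> 0" using G(2) ideal_0[OF I] by blast
  have var: "var i \<in> hom_comp n 1" if "i < n" for i
    using hom_comp_monom[of n "Poly_Mapping.single i (Suc 0)"] that by simp
  have gV: "?g i \<in> ?V" if "i < n" for i
  proof -
    have "?g i \<in> hom_comp n (1 + e)" by (rule hom_comp_mult[OF var[OF that] G(1)])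
    moreover have "?g i \<in> J"
      using var[OF that] by (intro ideal_mult[OF J(1) _ J(3)]) (simp add: hom_comp_def)
    ultimately show ?thesis by simp
  qed
  \<comment> \<open>Cancelling the nonzero \<open>G\<close> shows that the multiples are distinct,
    so \<open>card A\<close> counts the basis vectors added to \<open>B\<close>.\<close>
  have inj: "inj ?g"
  proof (rule injI)
    fix i j assume "?g i = ?g j"
    then have "var i = (var j :: 'k mpoly)" using G0 by simp
    then have "Poly_Mapping.single i (Suc 0) = Poly_Mapping.single j (Suc 0)"
      by (rule injD[OF inj_monom])
    then have "lk (Poly_Mapping.single j (Suc 0)) i = Suc 0" by (metis lookup_single_eq)
    then show "i = j" by (auto simp: lookup_single when_def split: if_splits)
  qed
  obtain B where B: "B \<subseteq> ?U" "kv.independent B" "?U \<subseteq> kv.span B" "card B = kv.dim ?U"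
    by (rule kv.basis_exists)
  obtain C where C: "B \<subseteq> C" "C \<subseteq> B \<union> ?g ` {..<n}" "kv.independent C" "B \<union> ?g ` {..<n} \<subseteq> kv.span C"
    using kv.maximal_independent_subset_extend[of B "B \<union> ?g ` {..<n}"] B(2) by blast
  define A where "A = {i. i < n \<and> ?g i \<in> C - B}"
  have A: "A \<subseteq> {..<n}" "finite A" by (auto simp: A_def)
  have CB: "C - B = ?g ` A" using C(2) by (auto simp: A_def)
  have CV: "C \<subseteq> ?V" using C(2) B(1) J(2) gV by blast
  have "C \<subseteq> kv.span (monom ` Mon n (Suc e))" using CV hom_comp_span by blast
  then have finC: "finite C"
    using kv.independent_span_bound[of "monom ` Mon n (Suc e)" C] C(3) by simp
  then have finB: "finite B" using C(1) finite_subset by blast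
  have "card (C - B) = card A"
    unfolding CB using inj by (intro card_image) (auto intro: inj_on_subset)
  then have "card C = kdim ?U + card A"
    using card_Un_disjoint[of B "C - B"] finC finB C(1) B(4) by (simp add: kdim_def Un_absorb1 Un_Diff_cancel)
  moreover have "card C \<le> kdim ?V"
    using kdim_mono[OF CV, of n "Suc e"] C(3) by (simp add: kdim_def kv.dim_eq_card_independent)
  ultimately have dim: "kdim ?U + card A \<le> kdim ?V" by simp
  \<comment> \<open>Every multiple lies in the span of \<open>C\<close>. Its part over
    \<open>B\<close> is in \<open>?I\<close>, and moving the other part to the left gives a linear
    form that sends \<open>G\<close> into \<open>?I\<close>.\<close>
  have "\<exists>c. (var i - (\<Sum>a\<in>A. Poly_Mapping.single 0 (c a) * var a)) * G \<in> ?I" if i: "i < n" for i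
  proof -
    have "B \<union> ?g ` A = C" using C(1) CB by blast
    then have "?g i \<in> kv.span (B \<union> ?g ` A)" using C(4) i by auto
    then obtain u v where uv: "?g i = u + v" "u \<in> kv.span B" "v \<in> kv.span (?g ` A)"
      unfolding kv.span_Un by blast
    obtain q where "v = (\<Sum>x\<in>?g ` A. kscale (q x) x)"
      using uv(3) A(2) by (auto simp: kv.span_finite)
    also have "\<dots> = (\<Sum>a\<in>A. kscale (q (?g a)) (?g a))"
      using inj by (subst sum.reindex) (auto intro: inj_on_subset)
    also have "\<dots> = (\<Sum>a\<in>A. Poly_Mapping.single 0 (q (?g a)) * var a) * G"
      by (simp add: kscale_eq sum_distrib_right mult.assoc)
    finally have "(var i - (\<Sum>a\<in>A. Poly_Mapping.single 0 (q (?g a)) * var a)) * G = u"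
      using uv(1) by (simp add: left_diff_distrib)
    moreover have "u \<in> ?I"
      using uv(2) kv.span_minimal[OF B(1) subspace_ideal[OF I]] by blast
    ultimately show ?thesis by (intro exI[of _ "\<lambda>a. q (?g a)"]) simp
  qed
  then have "\<forall>i. \<exists>c. i < n \<longrightarrow> (var i - (\<Sum>a\<in>A. Poly_Mapping.single 0 (c a) * var a)) * G \<in> ?I"
    by (intro allI) (simp only: ex_simps simp_thms, rule impI)
  from choice[OF this] obtain c where
    c: "\<forall>i. i < n \<longrightarrow> (var i - (\<Sum>a\<in>A. Poly_Mapping.single 0 (c i a) * var a)) * G \<in> ?I" ..
  have "(\<Sum>s<n - card A. d s) \<le> e + (n - card A)"
    by (rule annihilator_degree[OF fh freg sorted G A(1) c[rule_format]])
  moreover have "card A \<le> n" using card_mono[OF _ A(1)] by simp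
  \<comment> \<open>For this \<open>w\<close> the gain \<open>n - w\<close> is
    \<open>card A\<close>.\<close>
  ultimately show ?thesis using dim by (intro exI[of _ "n - card A"]) auto
qed

text \<open>Applied to \<open>G\<close> in its own degree, this yields the final \<open>1\<close> in
  the multiplicity bound.\<close>

lemma kdim_insert_le:
  assumes I: "is_ideal n I" and J: "is_ideal n J" "I \<subseteq> J"
    and G: "G \<in> hom_comp n e" "G \<notin> I" "G \<in> J"
  shows "Suc (kdim (I \<inter> hom_comp n e)) \<le> kdim (J \<inter> hom_comp n e)"
proof -
  let ?U = "I \<inter> hom_comp n e"
  have "G \<notin> kv.span ?U"
    using G(2) subspace_ideal[OF I] by (simp add: kv.span_eq_iff[THEN iffD2])
  moreover have "?U \<subseteq> kv.span (monom ` Mon n e)" using hom_comp_span by blast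
  ultimately have "Suc (kdim ?U) = kdim (insert G ?U)"
    unfolding kdim_def by (intro kv.dim_insert_finite[symmetric]) auto
  also have "\<dots> \<le> kdim (J \<inter> hom_comp n e)"
    using G J(2) by (intro kdim_mono) auto
  finally show ?thesis .
qed

text \<open>A form outside the ideal makes the Hilbert function of the quotient positive in degree
  \<open>e\<close>, and that number counts the box. Hence the lex monomial exists and
  \<open>d i\<close> is positive for \<open>i < n\<close>.\<close>

lemma Box_nonempty:
  fixes f :: "nat \<Rightarrow> 'k::field mpoly"
  assumes fh: "\<And>i. i < n \<Longrightarrow> f i \<in> hom_comp n (d i)"
    and freg: "regular_sequence n n f"
    and G: "G \<in> hom_comp n e" "G \<notin> ideal_gen n (f ` {..<n})"
  shows "Box n n d e \<noteq> {}"
proof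
  assume "Box n n d e = {}"
  then have "kdim (hom_comp n e :: 'k mpoly set) = kdim (ideal_gen n (f ` {..<n}) \<inter> hom_comp n e)"
    using kdim_regular_sequence[OF fh freg, of n e] by simp
  moreover have "f ` {..<n} \<subseteq> polyring n" using freg by (auto simp: regular_sequence_def)
  from is_ideal_gen[OF this] have I: "is_ideal n (ideal_gen n (f ` {..<n}))" .
  have "is_ideal n (polyring n :: 'k mpoly set)" by (rule is_idealI) auto
  from kdim_insert_le[OF I this _ G]
  have "Suc (kdim (ideal_gen n (f ` {..<n}) \<inter> hom_comp n e)) \<le> kdim (polyring n \<inter> hom_comp n e :: 'k mpoly set)"
    using ideal_polyring[OF I] G(1) by (auto simp: hom_comp_def)
  moreover have "polyring n \<inter> hom_comp n e = (hom_comp n e :: 'k mpoly set)"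
    by (auto simp: hom_comp_def)
  ultimately show False by simp
qed

lemma socle_degree:
  fixes f :: "nat \<Rightarrow> 'k::field mpoly"
  assumes fh: "\<And>i. i < n \<Longrightarrow> f i \<in> hom_comp n (d i)"
    and freg: "regular_sequence n n f"
    and sorted: "\<And>i j. i \<le> j \<Longrightarrow> j < n \<Longrightarrow> d i \<le> d j"
    and G: "G \<in> hom_comp n e" "G \<notin> ideal_gen n (f ` {..<n})"
    and e: "e < sigma n d"
  shows "\<exists>i<n. var i * G \<notin> ideal_gen n (f ` {..<n})"
proof (rule ccontr)
  assume "\<not> ?thesis"
  then have "(\<Sum>s<n - card ({} :: nat set). d s) \<le> e + (n - card ({} :: nat set))"
    by (intro annihilator_degree[OF fh freg sorted G, where A = "{}" and c = "\<lambda>_ _. 0"]) auto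
  \<comment> \<open>A monomial in the box forces \<open>d s > 0\<close>, so the truncated
    subtraction in \<open>sigma\<close> is exact and the inequality reads
    \<open>sigma n d \<le> e\<close>.\<close>
  moreover have "(\<Sum>s<n. d s) = (\<Sum>s<n. (d s - 1) + 1)"
    using Box_nonempty[OF fh freg G] by (intro sum.cong) (auto simp: Box_def)
  moreover have "(\<Sum>s<n. (d s - 1) + 1) = sigma n d + n"
    unfolding sigma_def by (subst sum.distrib) simp
  ultimately show False using e by simp
qed

theorem theorem3p2:
  fixes n :: nat and d :: "nat \<Rightarrow> nat" and D :: nat
    and f :: "nat \<Rightarrow> 'k::field mpoly" and G :: "'k mpoly"
  assumes sorted: "\<And>i j. i \<le> j \<Longrightarrow> j < n \<Longrightarrow> d i \<le> d j"
    and f_hom: "\<And>i. i < n \<Longrightarrow> homogeneous n (d i) (f i)"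
    and f_reg: "regular_sequence n n f"
    and G_hom: "homogeneous n D G"
    and G_notin: "G \<notin> ideal_gen n (f ` {..<n})"
    and artinian: "artinian_quot n (ideal_gen n (f ` {..<n} \<union> {G}))"
    and D_le: "D \<le> sigma n d"
  shows "(\<forall>m. D < m \<and> m \<le> sigma n d \<longrightarrow>
            int (HF_quot n (ideal_gen n (f ` {..<n} \<union> {G})) m)
              \<le> int (HF_quot n (pow_ideal n d :: 'k mpoly set) m) - phi TYPE('k) n d m)
       \<and> int (mult_quot n (ideal_gen n (f ` {..<n} \<union> {G})))
              \<le> (\<Prod>i<n. int (d i)) - (\<Sum>m\<in>{D+1..sigma n d}. phi TYPE('k) n d m) - 1"
proof -
  let ?I = "ideal_gen n (f ` {..<n})" and ?J = "ideal_gen n (f ` {..<n} \<union> {G})"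
  let ?HF = "HF_quot n ?J" and ?N = "\<lambda>m. card (Box n n d m)" and ?phi = "phi TYPE('k) n d"
  have fh: "f i \<in> hom_comp n (d i)" if "i < n" for i using f_hom that by (simp add: homogeneous_def)
  have G: "G \<in> hom_comp n D" using G_hom by (simp add: homogeneous_def)
  have fR: "f ` {..<n} \<subseteq> polyring n" using f_reg by (auto simp: regular_sequence_def)
  have fGR: "f ` {..<n} \<union> {G} \<subseteq> polyring n" using fR G by (auto simp: hom_comp_def)
  note I = is_ideal_gen[OF fR] and J = is_ideal_gen[OF fGR]
  have IJ: "?I \<subseteq> ?J" by (rule ideal_gen_mono) auto
  have GJ: "G \<in> ?J" by (rule ideal_gen_base) simp
  \<comment> \<open>The box count stands for the Hilbert function modulo \<open>?I\<close>, so a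
    drop below it is exactly the gain of \<open>?J\<close> over \<open>?I\<close>.\<close>
  have dims: "?HF m + kdim (?J \<inter> hom_comp n m) = ?N m + kdim (?I \<inter> hom_comp n m)" for m
    using HF_quot_add[of n ?J m] kdim_regular_sequence[OF fh f_reg, of n m] by simp
  have HF_le: "?HF m \<le> ?N m" for m
  proof -
    have "kdim (?I \<inter> hom_comp n m) \<le> kdim (?J \<inter> hom_comp n m)"
      using IJ by (intro kdim_mono) auto
    then show ?thesis using dims[of m] by linarith
  qed
  \<comment> \<open>\<open>?phi m\<close> compares degrees \<open>m - 1\<close> and
    \<open>m\<close>, so a form of degree exactly \<open>m - 1\<close> is required; \<open>G\<close>
    itself serves only \<open>m = D + 1\<close>.\<close>
  have multiple: "\<exists>H\<in>hom_comp n e. H \<in> ?J \<and> H \<notin> ?I" if "D \<le> e" "e \<le> sigma n d" for e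
    using that
  proof (induction e rule: dec_induct)
    case base
    then show ?case using G GJ G_notin by blast
  next
    case (step e)
    then obtain H where H: "H \<in> hom_comp n e" "H \<in> ?J" "H \<notin> ?I" by auto
    obtain i where i: "i < n" "var i * H \<notin> ?I"
      using socle_degree[OF fh f_reg sorted H(1,3)] step.prems by auto
    have v: "var i \<in> hom_comp n 1"
      using hom_comp_monom[of n "Poly_Mapping.single i (Suc 0)"] i(1) by simp
    have "var i * H \<in> hom_comp n (Suc e)" using hom_comp_mult[OF v H(1)] by simp
    moreover have "var i * H \<in> ?J" using v by (intro ideal_mult[OF J _ H(2)]) (simp add: hom_comp_def)
    ultimately show ?case using i(2) by blast
  qed
  have bound: "int (?HF m) \<le> int (?N m) - ?phi m" if m: "D < m" "m \<le> sigma n d" for m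
  proof -
    obtain e where e: "m = Suc e" using m(1) by (cases m) auto
    then obtain H where H: "H \<in> hom_comp n e" "H \<in> ?J" "H \<notin> ?I" using multiple[of e] m by auto
    obtain w where w: "w \<le> n" "(\<Sum>s<w. d s) \<le> e + w"
      "kdim (?I \<inter> hom_comp n m) + (n - w) \<le> kdim (?J \<inter> hom_comp n m)"
      using kdim_growth[OF fh f_reg sorted H(1,3) J IJ H(2)] unfolding e by blast
    have "?phi m \<le> int (n - w)"
      unfolding e by (rule phi_le[OF Box_nonempty[OF fh f_reg H(1,3)] w(1,2)])
    then show ?thesis using dims[of m] w(3) by linarith
  qed
  have HF_D: "?HF D + 1 \<le> ?N D"
    using dims[of D] kdim_insert_le[OF I J IJ G G_notin GJ] by linarith
  have HF_0: "?HF m = 0" if "sigma n d < m" for m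
  proof -
    have "Box n n d m = {}" using mdeg_Box_le[of _ n d m] that by (auto simp: not_le[symmetric])
    then show ?thesis using HF_le[of m] by simp
  qed
  let ?vanish = "\<lambda>N. \<forall>j\<ge>N. ?HF j = 0"
  have vanish: "?vanish (Suc (sigma n d))" using HF_0 by simp
  have "mult_quot n ?J = (\<Sum>j<(LEAST N. ?vanish N). ?HF j)" by (simp only: mult_quot_def)
  \<comment> \<open>\<open>mult_quot\<close> stops where the quotient starts to vanish for good,
    possibly before \<open>sigma n d\<close>; the summands added here are zero.\<close>
  also have "\<dots> = (\<Sum>j\<le>sigma n d. ?HF j)"
  proof (rule sum.mono_neutral_left)
    show "{..<(LEAST N. ?vanish N)} \<subseteq> {..sigma n d}"
    proof
      fix j assume "j \<in> {..<(LEAST N. ?vanish N)}"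
      then have "j < (LEAST N. ?vanish N)" by (simp only: lessThan_iff)
      then have "j < Suc (sigma n d)" using Least_le[of ?vanish, OF vanish] by (rule less_le_trans)
      then show "j \<in> {..sigma n d}" by simp
    qed
    have L: "?vanish (LEAST N. ?vanish N)" by (rule LeastI[of ?vanish, OF vanish])
    show "\<forall>j\<in>{..sigma n d} - {..<(LEAST N. ?vanish N)}. ?HF j = 0"
    proof
      fix j assume "j \<in> {..sigma n d} - {..<(LEAST N. ?vanish N)}"
      then have "(LEAST N. ?vanish N) \<le> j" by (simp only: Diff_iff lessThan_iff not_less)
      then show "?HF j = 0" using L by blast
    qed
  qed simp
  finally have mult: "int (mult_quot n ?J) = (\<Sum>j\<le>sigma n d. int (?HF j))" by simp
  \<comment> \<open>The guaranteed drop in degree \<open>j\<close>: nothing below \<open>D\<close>,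
    one for \<open>G\<close> at \<open>D\<close>, and \<open>?phi j\<close> above.\<close>
  let ?b = "\<lambda>j. (if j = D then 1 else 0) + (if D < j then ?phi j else 0)"
  have "(\<Sum>j\<le>sigma n d. int (?HF j)) \<le> (\<Sum>j\<le>sigma n d. int (?N j) - ?b j)"
  proof (rule sum_mono)
    fix j assume "j \<in> {..sigma n d}"
    then show "int (?HF j) \<le> int (?N j) - ?b j"
      using bound[of j] HF_le[of j] HF_D by (cases j D rule: linorder_cases) auto
  qed
  also have "\<dots> = (\<Prod>i<n. int (d i)) - (\<Sum>j\<le>sigma n d. ?b j)"
    unfolding sum_subtractf using sum_card_Box[of n d] by (simp flip: of_nat_sum of_nat_prod)
  also have "(\<Sum>j\<le>sigma n d. ?b j) = 1 + (\<Sum>m\<in>{D+1..sigma n d}. ?phi m)"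
  proof -
    have "(\<Sum>j\<le>sigma n d. if D < j then ?phi j else 0) = (\<Sum>m\<in>{D+1..sigma n d}. ?phi m)"
      by (rule sum.mono_neutral_cong_right) auto
    \<comment> \<open>\<open>D_le\<close> puts degree \<open>D\<close> in the summation range, so
      its \<open>1\<close> is counted.\<close>
    then show ?thesis using D_le by (simp add: sum.distrib)
  qed
  finally have "int (mult_quot n ?J) \<le> (\<Prod>i<n. int (d i)) - (\<Sum>m\<in>{D+1..sigma n d}. ?phi m) - 1"
    unfolding mult by linarith
  then show ?thesis using bound unfolding HF_pow_ideal by blast
qed

end
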